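(* Let $W,W_1,W_2,\ldots$ be i.i.d. random variables with values in $(0,1)$, let $P_i:=(1-W_1)\cdots(1-W_{i-1})W_i$ for $i\ge1$, and let $\Pi$ be a $P$-biased permutation of $\mathbb{N}_{+}$ for $P=(P_1,P_2,\ldots)$. If the distribution of $-\log(1-W)<\infty$ is non-lattice, meaning that the distribution of $1-W$ is not concentrated on a geometric progression $\{\rho^k:k\ge1\}$, $0<\rho<1$, and $$\mathbb{E}[-\log W]<\infty\quad\text{and}\quad\mathbb{E}[-\log(1-W)]<\infty,$$ then $\Pi$ is a positive recurrent regenerative permutation.
   Context: $\mathbb{N}_{+}=\{1,2,\ldots\}$, $\mathbb{N}_0=\{0,1,2,\ldots\}$, $[n]=\{1,\ldots,n\}$. A permutation of a set is a bijection of it; $\Pi_i=\Pi(i)$. **$P$-biased permutation.** Let $P=(P_1,P_2,\ldots)$ be a random probability distribution on $\mathbb{N}_{+}$ with all $P_i>0$. Conditionally given $P$, let $X_1,X_2,\ldots$ be i.i.d. with distribution $P$. Then $\Pi=(\Pi_1,\Pi_2,\ldots)$ is the sequence of distinct values of $(X_1,X_2,\ldots)$ in order of appearance. **Regeneration.** A permutation $\Pi$ of $\mathbb{N}_{+}$ splits at $n$ if it maps $[n]$ onto itself; then $\Pi^n_i:=\Pi_{n+i}-n$, $i\in\mathbb{N}_{+}$. A delayed renewal process is $T_n=T_0+Y_1+\cdots+Y_n$ with $T_0\in\mathbb{N}_0$, $Y_i\in\mathbb{N}_{+}\cup\{\infty\}$ independent and the $Y_i$ identically distributed; it has zero delay if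 $T_0=0$. Put $R_n=\sum_{k\ge0}1(T_k=n)$. A random permutation $\Pi$ of $\mathbb{N}_{+}$ is regenerative with respect to $(T_n)$ if every finite $T_i$ is a splitting time of $\Pi$ (time $0$ being counted trivially), and for each $n>0$ with $\mathbb{P}(R_n=1)>0$, conditionally given $R_n=1$: (a) $(\Pi^n,R_{n+1},R_{n+2},\ldots)\stackrel{(d)}{=}(\Pi^0,R^0_1,R^0_2,\ldots)$, for some random permutation $\Pi^0$ of $\mathbb{N}_{+}$ with renewal indicators $R^0$ of a zero-delay renewal process (not depending on $n$); (b) $(R_0,\ldots,R_n)$ is independent of $(\Pi^n,R_{n+1},R_{n+2},\ldots)$. Here the renewal process is $T_0=0$ together with the successive splitting times of $\Pi$. Positive recurrent means $\mathbb{E}(Y_1)<\infty$, where $Y_1$ is the first splitting time of $\Pi$; equivalently $\lim_n\mathbb{P}(\Pi\text{ splits at }n)>0$. *)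

theory Defs
  imports "HOL-Probability.Probability"
begin

text \<open>
  Positions and values of sequences and permutations are counted from \<open>0\<close>: the natural
  number \<open>i\<close> stands for the element \<open>i + 1\<close> of \<open>{1, 2, \<dots>}\<close>, so that the
  initial segment \<open>{1, \<dots>, n}\<close> becomes \<open>{..<n}\<close>. Times (splitting times, renewal
  times) are not shifted. Null sets are disregarded: a random permutation is a random sequence that
  is almost surely a permutation.
\<close>

abbreviation seq_space :: "(nat \<Rightarrow> 'b) measure" where
  "seq_space \<equiv> PiM UNIV (\<lambda>_. count_space UNIV)"

definition random_permutation :: "'a measure \<Rightarrow> ('a \<Rightarrow> nat \<Rightarrow> nat) \<Rightarrow> bool" where
  "random_permutation M \<sigma> \<longleftrightarrow> \<sigma> \<in> measurable M seq_space \<and> (AE \<omega> in M. bij (\<sigma> \<omega>))"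


subsection \<open>Biased permutations\<close>

definition cond_iid_given :: "'a measure \<Rightarrow> ('a \<Rightarrow> nat \<Rightarrow> real) \<Rightarrow> ('a \<Rightarrow> nat \<Rightarrow> nat) \<Rightarrow> bool" where
  "cond_iid_given M P X \<longleftrightarrow>
     P \<in> measurable M (PiM UNIV (\<lambda>_. borel)) \<and> X \<in> measurable M seq_space \<and>
     (\<forall>n x. AE \<omega> in M.
        real_cond_exp M (vimage_algebra (space M) P (PiM UNIV (\<lambda>_. borel)))
          (indicator {\<omega> \<in> space M. \<forall>j<n. X \<omega> j = x j}) \<omega>
        = (\<Prod>j<n. P \<omega> (x j)))"

text \<open>
  The set enumerated below consists of the indices at which a value appears for the first time.
  It is almost surely infinite in the intended application; for finite sets \<^const>\<open>enumerate\<close>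
  returns irrelevant values beyond the cardinality.
\<close>

definition distinct_values :: "(nat \<Rightarrow> 'b) \<Rightarrow> nat \<Rightarrow> 'b" where
  "distinct_values x i = x (enumerate {j. \<forall>l<j. x l \<noteq> x j} i)"

text \<open>
  That \<open>P\<close> is almost surely a probability distribution is not listed separately, since it is
  forced by \<open>P\<close> being the conditional distribution of a variable with values in \<open>nat\<close>.
\<close>

definition biased_permutation :: "'a measure \<Rightarrow> ('a \<Rightarrow> nat \<Rightarrow> real) \<Rightarrow> ('a \<Rightarrow> nat \<Rightarrow> nat) \<Rightarrow> bool" where
  "biased_permutation M P \<sigma> \<longleftrightarrow>
     \<sigma> \<in> measurable M seq_space \<and>
     (\<exists>X. cond_iid_given M P X \<and> (AE \<omega> in M. \<sigma> \<omega> = distinct_values (X \<omega>)))"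


subsection \<open>Renewal processes\<close>

text \<open>
  Being a renewal process is a property of the law of \<open>T\<close>: it is the law of
  \<open>T\<^sub>0 + Y\<^sub>1 + \<dots> + Y\<^sub>n\<close> for independent \<open>T\<^sub>0\<close>, \<open>Y\<^sub>1\<close>, \<open>Y\<^sub>2\<close>, \dots with \<open>T\<^sub>0\<close> distributed as \<open>d\<close>
  and every \<open>Y\<^sub>i\<close> distributed as \<open>p\<close>. (The increments following an infinite one cannot be recovered
  from \<open>T\<close>, hence are not asked to live on the space of \<open>T\<close>.)
\<close>

definition renewal_process :: "nat pmf \<Rightarrow> enat pmf \<Rightarrow> 'a measure \<Rightarrow> ('a \<Rightarrow> nat \<Rightarrow> enat) \<Rightarrow> bool" where
  "renewal_process d p M T \<longleftrightarrow>
     0 \<notin> set_pmf p \<and> T \<in> measurable M seq_space \<and>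
     distr M seq_space T =
       distr (measure_pmf d \<Otimes>\<^sub>M PiM UNIV (\<lambda>_. measure_pmf p)) seq_space
         (\<lambda>(t0, y) n. enat t0 + (\<Sum>i<n. y i))"

definition delayed_renewal :: "'a measure \<Rightarrow> ('a \<Rightarrow> nat \<Rightarrow> enat) \<Rightarrow> bool" where
  "delayed_renewal M T \<longleftrightarrow> (\<exists>d p. renewal_process d p M T)"

definition zero_delay_renewal :: "'a measure \<Rightarrow> ('a \<Rightarrow> nat \<Rightarrow> enat) \<Rightarrow> bool" where
  "zero_delay_renewal M T \<longleftrightarrow> (\<exists>p. renewal_process (return_pmf 0) p M T)"

text \<open>The cardinality is the sum over \<open>k\<close> of the indicators of \<open>t k = n\<close>.\<close>

definition renewal_indicator :: "(nat \<Rightarrow> enat) \<Rightarrow> nat \<Rightarrow> nat" where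
  "renewal_indicator t n = card {k. t k = enat n}"


subsection \<open>Regeneration\<close>

definition splits_at :: "(nat \<Rightarrow> nat) \<Rightarrow> nat \<Rightarrow> bool" where
  "splits_at \<pi> n \<longleftrightarrow> \<pi> ` {..<n} = {..<n}"

text \<open>Time \<open>0\<close> followed by the positive splitting times in increasing order, and then \<open>\<infinity>\<close> forever
  if there are only finitely many of them (the infimum of the empty set being \<open>\<infinity>\<close>).\<close>

primrec splitting_time :: "(nat \<Rightarrow> nat) \<Rightarrow> nat \<Rightarrow> enat" where
  "splitting_time \<pi> 0 = 0"
| "splitting_time \<pi> (Suc k) = Inf {enat n | n. splitting_time \<pi> k < enat n \<and> splits_at \<pi> n}"

text \<open>The pair of the permutation \<open>\<sigma>\<^sup>n\<close> and of the indicators at the times \<open>n + 1\<close>, \<open>n + 2\<close>, \dots\<close>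

definition future :: "nat \<Rightarrow> (nat \<Rightarrow> nat) \<Rightarrow> (nat \<Rightarrow> enat) \<Rightarrow> (nat \<Rightarrow> nat) \<times> (nat \<Rightarrow> nat)" where
  "future n \<pi> t = (\<lambda>i. \<pi> (n + i) - n, \<lambda>k. renewal_indicator t (n + k + 1))"

text \<open>The library notion \<^const>\<open>prob_space.indep_var\<close> requires both variables to have the same
  type; this is its characterization by generated sigma-algebras, for arbitrary types.\<close>

definition independent_vars ::
  "'a measure \<Rightarrow> 'b measure \<Rightarrow> ('a \<Rightarrow> 'b) \<Rightarrow> 'c measure \<Rightarrow> ('a \<Rightarrow> 'c) \<Rightarrow> bool" where
  "independent_vars M S X S' Y \<longleftrightarrow>
     X \<in> measurable M S \<and> Y \<in> measurable M S' \<and>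
     prob_space.indep_set M (sets (vimage_algebra (space M) X S)) (sets (vimage_algebra (space M) Y S'))"

definition given_renewal :: "'a measure \<Rightarrow> ('a \<Rightarrow> nat \<Rightarrow> enat) \<Rightarrow> nat \<Rightarrow> 'a measure" where
  "given_renewal M T n = uniform_measure M {\<omega> \<in> space M. renewal_indicator (T \<omega>) n = 1}"

text \<open>
  The pair of \<open>\<sigma>\<^sup>0\<close> and the zero-delay renewal process enter only through their joint law; they are
  realized as the coordinate maps under a probability measure \<open>Q\<close>.
\<close>

definition regenerative :: "'a measure \<Rightarrow> ('a \<Rightarrow> nat \<Rightarrow> nat) \<Rightarrow> ('a \<Rightarrow> nat \<Rightarrow> enat) \<Rightarrow> bool" where
  "regenerative M \<sigma> T \<longleftrightarrow>
     random_permutation M \<sigma> \<and> delayed_renewal M T \<and>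
     (AE \<omega> in M. \<forall>i m. T \<omega> i = enat m \<longrightarrow> splits_at (\<sigma> \<omega>) m) \<and>
     (\<exists>Q :: ((nat \<Rightarrow> nat) \<times> (nat \<Rightarrow> enat)) measure.
        prob_space Q \<and> sets Q = sets (seq_space \<Otimes>\<^sub>M seq_space) \<and>
        random_permutation Q fst \<and> zero_delay_renewal Q snd \<and>
        (\<forall>n>0. measure M {\<omega> \<in> space M. renewal_indicator (T \<omega>) n = 1} > 0 \<longrightarrow>
           distr (given_renewal M T n) (seq_space \<Otimes>\<^sub>M seq_space) (\<lambda>\<omega>. future n (\<sigma> \<omega>) (T \<omega>))
             = distr Q (seq_space \<Otimes>\<^sub>M seq_space) (\<lambda>(\<pi>, t). future 0 \<pi> t) \<and>
           independent_vars (given_renewal M T n)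
             (PiM {..n} (\<lambda>_. count_space UNIV)) (\<lambda>\<omega>. \<lambda>i\<in>{..n}. renewal_indicator (T \<omega>) i)
             (seq_space \<Otimes>\<^sub>M seq_space) (\<lambda>\<omega>. future n (\<sigma> \<omega>) (T \<omega>))))"

definition positive_recurrent_regenerative :: "'a measure \<Rightarrow> ('a \<Rightarrow> nat \<Rightarrow> nat) \<Rightarrow> bool" where
  "positive_recurrent_regenerative M \<sigma> \<longleftrightarrow>
     regenerative M \<sigma> (\<lambda>\<omega>. splitting_time (\<sigma> \<omega>)) \<and>
     (\<integral>\<^sup>+ \<omega>. ennreal_of_enat (splitting_time (\<sigma> \<omega>) 1) \<partial>M) < \<infinity>"

end

theory Submission imports Defs begin

text \<open>
  Given \<open>P\<close>, a sample from \<open>P\<close> shows the new values \<open>x\<^sub>0, \<dots>, x\<^sub>m\<close> first, in this order, with probability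
  \<open>\<Prod>\<^sub>i P (x\<^sub>i) / (1 - (\<Sum>\<^sub>l\<^sub><\<^sub>i P (x\<^sub>l)))\<close>. Suppose that the first \<open>n\<close> of these values form a permutation of
  \<open>{..<n}\<close>. Then the first \<open>n\<close> factors are functions of \<open>W\<^sub>0, \<dots>, W\<^sub>n\<^sub>-\<^sub>1\<close>; in the remaining ones the common
  factor \<open>S = (1 - W\<^sub>0) \<cdots> (1 - W\<^sub>n\<^sub>-\<^sub>1)\<close> of the weights \<open>P n, P (n + 1), \<dots>\<close> cancels, and what is left is
  the same product for the weights built from \<open>W\<^sub>n, W\<^sub>n\<^sub>+\<^sub>1, \<dots>\<close>. As the \<open>W\<^sub>i\<close> are i.i.d., the probability that
  \<open>\<sigma>\<close> starts with a permutation of \<open>{..<n}\<close> followed by \<open>n + y\<^sub>0, n + y\<^sub>1, \<dots>\<close> is the product of the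
  probabilities that \<open>\<sigma>\<close> starts with that permutation and that \<open>\<sigma>\<close> starts with \<open>y\<^sub>0, y\<^sub>1, \<dots>\<close>
  (\<open>mean_succ_prob_append\<close>). Besides the almost sure bijectivity of \<open>\<sigma>\<close>, this factorization is all
  that the regenerative property needs: given a split at \<open>n\<close>, the shifted permutation is independent of the first \<open>n\<close> values and distributed as \<open>\<sigma>\<close>
  (\<open>regeneration\<close>).

  For positive recurrence let \<open>u\<^sub>n\<close> be the probability of a split at \<open>n\<close> and \<open>Y\<close> the first splitting time.
  Splitting an outcome according to the last split up to time \<open>n\<close> gives \<open>\<Sum>\<^sub>k\<^sub>\<le>\<^sub>n u\<^sub>k \<cdot> \<P>(Y > n - k) \<le> 1\<close>, so
  \<open>\<E>(Y) \<le> 1 / c\<close> as soon as \<open>u\<^sub>n \<ge> c > 0\<close> for all large \<open>n\<close> (\<open>finite_mean_splitting_time\<close>).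

  Such a bound comes from a direct estimate. Given \<open>P\<close>, a split at \<open>n\<close> occurs if the first \<open>k\<close> samples
  cover exactly \<open>{..<n}\<close>, and the probability of this is at least
  \<open>(1 - S)\<^sup>k (1 - \<Sum>\<^sub>i\<^sub><\<^sub>n (1 - P i)\<^sup>k)\<close>. Take \<open>k\<close> to be about \<open>a / S\<close>. For \<open>S \<le> 1 / 2\<close> the first factor is bounded
  below, and the sum is at most \<open>\<Sum>\<^sub>i\<^sub><\<^sub>n exp (- a P i / S)\<close>, where
  \<open>P i / S = W\<^sub>i / ((1 - W\<^sub>i) \<cdots> (1 - W\<^sub>n\<^sub>-\<^sub>1))\<close>. The denominator has mean \<open>r\<^sup>n\<^sup>-\<^sup>i\<close> with \<open>r = \<E>(1 - W) < 1\<close>, and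
  \<open>\<Sum>\<^sub>m \<P>(W < q\<^sup>m) < \<infinity>\<close> for \<open>q < 1\<close> because \<open>\<E>(- log W) < \<infinity>\<close>. By Markov's inequality and a union bound, outside
  an event whose probability stays away from \<open>1\<close>, these ratios are at least \<open>b (n - i)\<close> for a fixed sequence
  \<open>b\<close> that grows geometrically, and the sum is then at most \<open>1 / 2\<close> for suitable \<open>a\<close> (\<open>ex_prob_split_ge\<close>).
\<close>

section \<open>Order of first appearance\<close>

lemma map_upt_eq_iff: "map f [0..<k] = l \<longleftrightarrow> length l = k \<and> (\<forall>j<k. f j = l ! j)"
  by (auto simp: list_eq_iff_nth_eq)

text \<open>The distinct elements of a list in the order of their first occurrences; \<^const>\<open>remdups\<close>
  on its own keeps the last occurrences.\<close>

definition appearance :: "'b list \<Rightarrow> 'b list" where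
  "appearance l = rev (remdups (rev l))"

lemma appearance_Nil [simp]: "appearance [] = []"
  by (simp add: appearance_def)

lemma appearance_snoc [simp]:
  "appearance (l @ [y]) = (if y \<in> set l then appearance l else appearance l @ [y])"
  by (simp add: appearance_def)

lemma set_appearance [simp]: "set (appearance l) = set l"
  by (simp add: appearance_def)

lemma distinct_appearance [simp]: "distinct (appearance l)"
  by (simp add: appearance_def)

text \<open>The indices at which a sequence takes a new value.\<close>

definition first_times :: "(nat \<Rightarrow> 'b) \<Rightarrow> nat set" where
  "first_times x = {j. \<forall>l<j. x l \<noteq> x j}"

lemma distinct_values_conv: "distinct_values x = x \<circ> enumerate (first_times x)"
  by (simp add: fun_eq_iff distinct_values_def first_times_def)

lemma range_first_times: "x ` first_times x = range x"
proof -
  have "\<exists>j\<in>first_times x. x j = x i" for i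
  proof (rule bexI[of _ "LEAST j. x j = x i"])
    show least: "x (LEAST j. x j = x i) = x i" by (rule LeastI[of _ i]) simp
    show "(LEAST j. x j = x i) \<in> first_times x" using not_less_Least least by (auto simp: first_times_def)
  qed
  then show ?thesis unfolding image_def by (auto intro: sym)
qed

lemma infinite_first_times: "infinite (range x) \<Longrightarrow> infinite (first_times x)"
  by (metis finite_imageI range_first_times)

lemma inj_on_first_times: "inj_on x (first_times x)"
  unfolding inj_on_def first_times_def by (metis (mono_tags, lifting) linorder_neqE_nat mem_Collect_eq)

lemma inj_distinct_values:
  assumes "infinite (range x)"
  shows "inj (distinct_values x)"
proof -
  have "inj (x \<circ> enumerate (first_times x))"
    using bij_enumerate[OF infinite_first_times[OF assms]] inj_on_first_times[of x]
    by (intro comp_inj_on) (simp_all add: bij_betw_def)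
  then show ?thesis by (simp add: distinct_values_conv)
qed

lemma range_distinct_values:
  assumes "infinite (range x)"
  shows "range (distinct_values x) = range x"
proof -
  have "range (distinct_values x) = x ` range (enumerate (first_times x))"
    by (simp add: distinct_values_conv image_comp)
  also have "range (enumerate (first_times x)) = first_times x"
    using bij_enumerate[OF infinite_first_times[OF assms]] by (simp add: bij_betw_def)
  finally show ?thesis by (simp add: range_first_times)
qed

lemma card_less_enumerate:
  fixes J :: "nat set"
  assumes "infinite J"
  shows "card {j\<in>J. j < enumerate J n} = n"
proof -
  have "{j\<in>J. j < enumerate J n} = enumerate J ` {..<n}"
  proof (intro set_eqI iffI)
    fix j assume "j \<in> {j\<in>J. j < enumerate J n}"
    then obtain m where "j = enumerate J m" "enumerate J m < enumerate J n"
      using enumerate_Ex[OF assms] by blast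
    with assms show "j \<in> enumerate J ` {..<n}" by auto
  qed (use assms in \<open>auto simp: enumerate_in_set\<close>)
  then show ?thesis
    using inj_enumerate[OF assms] by (simp add: card_image inj_on_subset)
qed

lemma enumerate_card_less:
  fixes J :: "nat set"
  assumes "infinite J" "k \<in> J"
  shows "enumerate J (card {j\<in>J. j < k}) = k"
  by (metis assms card_less_enumerate enumerate_Ex)

lemma appearance_eq_distinct_values:
  assumes "infinite (range x)"
  shows "appearance (map x [0..<k]) =
    map (distinct_values x) [0..<card {j\<in>first_times x. j < k}]"
proof (induction k)
  case 0
  then show ?case by simp
next
  case (Suc k)
  let ?J = "first_times x"
  show ?case
  proof (cases "k \<in> ?J")
    case True
    then have eq: "{j\<in>?J. j < Suc k} = insert k {j\<in>?J. j < k}" by (auto simp: less_Suc_eq)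
    have "distinct_values x (card {j\<in>?J. j < k}) = x k"
      using enumerate_card_less[OF infinite_first_times[OF assms] True]
      by (simp add: distinct_values_conv)
    moreover have "x k \<notin> x ` {0..<k}" using True by (force simp: first_times_def)
    moreover have "card {j\<in>?J. j < Suc k} = Suc (card {j\<in>?J. j < k})" by (subst eq) simp
    ultimately show ?thesis by (simp add: Suc)
  next
    case False
    then have eq: "{j\<in>?J. j < Suc k} = {j\<in>?J. j < k}" by (auto simp: less_Suc_eq)
    obtain l where "l < k" "x l = x k" using False by (auto simp: first_times_def)
    then have "x k \<in> x ` {0..<k}" by (metis atLeastLessThan_iff imageI zero_le)
    then show ?thesis by (simp add: Suc eq)
  qed
qed

text \<open>This expresses the infinite enumeration by finite prefixes of the sequence: for a unique \<open>k\<close>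
  (\<open>appearance_prefix_unique\<close>), \<open>y\<close> turns up at index \<open>k\<close> just after \<open>xs\<close> has been seen.\<close>

lemma distinct_values_prefix_iff:
  assumes inf: "infinite (range x)" and y: "y \<notin> set xs"
  shows "map (distinct_values x) [0..<Suc (length xs)] = xs @ [y] \<longleftrightarrow>
    (\<exists>k. appearance (map x [0..<k]) = xs \<and> x k = y)" (is "?L \<longleftrightarrow> ?R")
proof -
  let ?J = "first_times x"
  note infJ = infinite_first_times[OF inf]
  show ?thesis
  proof
    assume L: ?L
    let ?k = "enumerate ?J (length xs)"
    have "appearance (map x [0..<?k]) = xs"
      unfolding appearance_eq_distinct_values[OF inf] card_less_enumerate[OF infJ]
      using L by simp
    moreover have "x ?k = y" using L by (simp add: distinct_values_conv)
    ultimately show ?R by blast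
  next
    assume ?R
    then obtain k where k: "appearance (map x [0..<k]) = xs" "x k = y" by blast
    then have "set xs = x ` {0..<k}" by (metis atLeastLessThan_upt set_appearance image_set)
    with k y have "x l \<noteq> x k" if "l < k" for l
      using that by (metis atLeastLessThan_iff imageI zero_le)
    then have "k \<in> ?J" by (simp add: first_times_def)
    have len: "card {j\<in>?J. j < k} = length xs"
      using k(1) by (subst (asm) appearance_eq_distinct_values[OF inf]) auto
    then have "enumerate ?J (length xs) = k"
      using enumerate_card_less[OF infJ \<open>k \<in> ?J\<close>] by simp
    moreover have "map (distinct_values x) [0..<length xs] = xs"
      using k(1) appearance_eq_distinct_values[OF inf, of k] unfolding len by simp
    ultimately show ?L using k(2) by (simp add: distinct_values_conv)
  qed
qed

lemma appearance_prefix_unique: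
  assumes "appearance (map x [0..<k]) = xs" "x k = y" "y \<notin> set xs"
    "appearance (map x [0..<k']) = xs" "x k' = y"
  shows "k = k'"
proof -
  have "set xs = x ` {0..<k}" "set xs = x ` {0..<k'}"
    using assms by (metis atLeastLessThan_upt set_appearance image_set)+
  with assms show ?thesis by (metis atLeastLessThan_iff imageI linorder_neqE_nat zero_le)
qed

section \<open>Successive sampling probabilities\<close>

text \<open>For distinct \<open>xs\<close>: the probability that the distinct values of an i.i.d. sample from \<open>p\<close>, in order of
  appearance, start with \<open>xs\<close>.\<close>

definition succ_prob :: "('b \<Rightarrow> real) \<Rightarrow> 'b list \<Rightarrow> real" where
  "succ_prob p xs = (\<Prod>i<length xs. p (xs ! i) / (1 - (\<Sum>l<i. p (xs ! l))))"

text \<open>The probability that \<open>k\<close> independent samples from \<open>p\<close> show exactly the values \<open>xs\<close>, in this order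
  of first appearance. It is a finite sum even if \<open>p\<close> has infinite support, since the sampled lists use
  elements of \<open>xs\<close> only.\<close>

definition order_prob :: "('b \<Rightarrow> real) \<Rightarrow> nat \<Rightarrow> 'b list \<Rightarrow> real" where
  "order_prob p k xs = (\<Sum>l | length l = k \<and> appearance l = xs. prod_list (map p l))"

lemma finite_lists_appearance [simp]: "finite {l. length l = k \<and> appearance l = xs}"
  by (rule finite_subset[OF _ finite_lists_length_eq[of "set xs" k]]) auto

lemma sum_nth_eq_sum_set:
  "distinct xs \<Longrightarrow> (\<Sum>l<length xs. p (xs ! l)) = (\<Sum>x\<in>set xs. p x :: real)"
  by (simp add: sum.distinct_set_conv_list sum_list_sum_nth atLeast0LessThan)

lemma succ_prob_Nil [simp]: "succ_prob p [] = 1"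
  by (simp add: succ_prob_def)

lemma succ_prob_snoc:
  assumes "distinct xs"
  shows "succ_prob p (xs @ [y]) = succ_prob p xs * p y / (1 - (\<Sum>x\<in>set xs. p x))"
  using assms by (simp add: succ_prob_def nth_append sum_nth_eq_sum_set)

lemma succ_prob_nonneg:
  assumes "\<And>x. p x > 0" "\<And>A. finite A \<Longrightarrow> sum p A < 1" "distinct xs"
  shows "0 \<le> succ_prob p xs"
  using assms(3)
proof (induction xs rule: rev_induct)
  case (snoc y xs)
  have "sum p (set xs) < 1" by (simp add: assms)
  with snoc assms(1)[of y] show ?case by (simp add: succ_prob_snoc)
qed simp

lemma order_prob_0: "order_prob p 0 xs = (if xs = [] then 1 else 0)"
proof -
  have "{l. length l = 0 \<and> appearance l = xs} = (if xs = [] then {[]} else {})" by auto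
  then show ?thesis by (simp add: order_prob_def)
qed

lemma order_prob_Suc_Nil:
  fixes p :: "'b \<Rightarrow> real"
  shows "order_prob p (Suc k) [] = 0"
proof -
  have "{l :: 'b list. length l = Suc k \<and> appearance l = []} = {}"
    by (metis (mono_tags, lifting) Collect_empty_eq Zero_not_Suc list.size(3) set_appearance set_empty)
  then show ?thesis unfolding order_prob_def by (simp only: sum.empty)
qed

text \<open>Conditioning on the last sample: it is either a value seen before or the new value \<open>y\<close>.\<close>

lemma order_prob_Suc_snoc:
  assumes "distinct (xs @ [y])"
  shows "order_prob p (Suc k) (xs @ [y]) =
    (\<Sum>x\<in>set (xs @ [y]). p x) * order_prob p k (xs @ [y]) + p y * order_prob p k xs"
proof -
  let ?L = "\<lambda>k zs. {l. length l = k \<and> appearance l = zs}"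
  let ?f = "\<lambda>(l, x). l @ [x]"
  let ?A = "?L k (xs @ [y]) \<times> set (xs @ [y])" and ?B = "?L k xs \<times> {y}"
  have "?L (Suc k) (xs @ [y]) = ?f ` (?A \<union> ?B)"
  proof (intro set_eqI iffI)
    fix l assume l: "l \<in> ?L (Suc k) (xs @ [y])"
    then obtain l' z where l': "l = l' @ [z]" "length l' = k" by (auto simp: length_Suc_conv_rev)
    show "l \<in> ?f ` (?A \<union> ?B)"
    proof (cases "z \<in> set l'")
      case True
      with l l' have "appearance l' = xs @ [y]" by simp
      with True l' have "(l', z) \<in> ?A" by (metis (mono_tags, lifting) SigmaI mem_Collect_eq set_appearance)
      with l'(1) show ?thesis by (intro image_eqI[of _ _ "(l', z)"]) simp_all
    next
      case False
      with l l' have "(l', z) \<in> ?B" by simp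
      with l'(1) show ?thesis by (intro image_eqI[of _ _ "(l', z)"]) simp_all
    qed
  next
    fix l assume "l \<in> ?f ` (?A \<union> ?B)"
    then consider l' z where "l = l' @ [z]" "(l', z) \<in> ?A" | l' where "l = l' @ [y]" "(l', y) \<in> ?B"
      by auto
    then show "l \<in> ?L (Suc k) (xs @ [y])"
    proof cases
      case 1
      then have "z \<in> set l'" by (metis (mono_tags, lifting) SigmaE2 mem_Collect_eq set_appearance)
      with 1 show ?thesis by simp
    next
      case 2
      then have "y \<notin> set l'" using assms set_appearance[of l'] by (simp del: set_appearance)
      with 2 show ?thesis by simp
    qed
  qed
  moreover have "inj_on ?f (?A \<union> ?B)" by (auto simp: inj_on_def)
  moreover have disj: "?A \<inter> ?B = {}" by auto
  ultimately have "order_prob p (Suc k) (xs @ [y]) =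
      (\<Sum>l\<in>?A \<union> ?B. prod_list (map p (?f l)))"
    unfolding order_prob_def by (simp add: sum.reindex)
  also have "\<dots> = (\<Sum>l\<in>?A. prod_list (map p (?f l))) + (\<Sum>l\<in>?B. prod_list (map p (?f l)))"
    by (rule sum.union_disjoint) (use disj in auto)
  also have "(\<Sum>l\<in>?A. prod_list (map p (?f l))) =
      (\<Sum>x\<in>set (xs @ [y]). p x) * order_prob p k (xs @ [y])"
  proof -
    have "(\<Sum>l\<in>?A. prod_list (map p (?f l))) =
        (\<Sum>l\<in>?A. prod_list (map p (fst l)) * p (snd l))"
      by (intro sum.cong) auto
    also have "\<dots> = order_prob p k (xs @ [y]) * (\<Sum>x\<in>set (xs @ [y]). p x)"
      unfolding order_prob_def sum_product sum.cartesian_product by (simp only: case_prod_unfold)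
    finally show ?thesis by (simp only: mult.commute)
  qed
  also have "(\<Sum>l\<in>?B. prod_list (map p (?f l))) = p y * order_prob p k xs"
  proof -
    have "(\<Sum>l\<in>?B. prod_list (map p (?f l))) = (\<Sum>l\<in>?B. prod_list (map p (fst l)) * p (snd l))"
      by (intro sum.cong) auto
    also have "\<dots> = order_prob p k xs * (\<Sum>x\<in>{y}. p x)"
      unfolding order_prob_def sum_product sum.cartesian_product by (simp only: case_prod_unfold)
    finally show ?thesis by simp
  qed
  finally show ?thesis .
qed

lemma order_prob_nonneg: "(\<And>x. p x \<ge> 0) \<Longrightarrow> 0 \<le> order_prob p k xs"
  unfolding order_prob_def
  by (intro sum_nonneg prod_list_nonneg) auto

text \<open>The expected number of \<open>k\<close> for which the first \<open>k\<close> samples show exactly \<open>xs\<close>. Multiplied by the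
  probability of a further value \<open>y\<close> it becomes \<^term>\<open>succ_prob p (xs @ [y])\<close>.\<close>

lemma sums_order_prob:
  assumes p: "\<And>x. p x > 0" "\<And>A. finite A \<Longrightarrow> sum p A < 1" and "distinct xs"
  shows "(\<lambda>k. order_prob p k xs) sums (succ_prob p xs / (1 - (\<Sum>x\<in>set xs. p x)))"
  using assms(3)
proof (induction xs rule: rev_induct)
  case Nil
  have "order_prob p k [] = (if k = 0 then 1 else 0)" for k
    by (cases k) (auto simp: order_prob_0 order_prob_Suc_Nil)
  then show ?case using sums_single[of 0 "\<lambda>_. 1::real"] by simp
next
  case (snoc y xs)
  let ?a = "\<lambda>k. order_prob p k (xs @ [y])" and ?b = "\<lambda>k. order_prob p k xs"
  define s where "s = (\<Sum>x\<in>set (xs @ [y]). p x)"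
  define B where "B = succ_prob p xs / (1 - (\<Sum>x\<in>set xs. p x))"
  have s: "s < 1" by (simp add: s_def p)
  have nn: "0 \<le> ?a k" "0 \<le> ?b k" for k
    by (intro order_prob_nonneg less_imp_le p(1))+
  have b: "?b sums B" using snoc by (simp add: B_def)
  have rec: "?a (Suc k) = s * ?a k + p y * ?b k" for k
    unfolding s_def by (rule order_prob_Suc_snoc[OF snoc.prems])
  have part: "(\<Sum>k<Suc n. ?a k) = s * (\<Sum>k<n. ?a k) + p y * (\<Sum>k<n. ?b k)" for n
  proof (induction n)
    case (Suc n)
    then show ?case
      unfolding sum.lessThan_Suc[of _ "Suc n"] rec sum.lessThan_Suc[of _ n] distrib_left by linarith
  qed (simp add: order_prob_0)
  \<comment> \<open>The limit of the recursion is a fixed point; boundedness of the partial sums makes the limit exist.\<close>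
  have "(\<Sum>k<n. ?a k) \<le> p y * B / (1 - s)" for n
  proof -
    have "(\<Sum>k<n. ?a k) \<le> s * (\<Sum>k<n. ?a k) + p y * (\<Sum>k<n. ?b k)"
      using part[of n] nn(1)[of n] by simp
    moreover have "(\<Sum>k<n. ?b k) \<le> B"
      using sums_unique[OF b] sums_summable[OF b] nn(2) by (simp add: sum_le_suminf)
    then have "p y * (\<Sum>k<n. ?b k) \<le> p y * B"
      using p(1)[of y] by simp
    ultimately have "(1 - s) * (\<Sum>k<n. ?a k) \<le> p y * B" by (simp add: algebra_simps)
    then show ?thesis using s by (simp add: field_simps)
  qed
  then have "summable ?a" by (intro summableI_nonneg_bounded nn)
  then obtain L where L: "?a sums L" by (auto simp: summable_def)
  have "?a sums (s * L + p y * B)"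
    using sums_Suc[of ?a, unfolded rec, OF sums_add[OF sums_mult[OF L] sums_mult[OF b]]]
    by (simp add: order_prob_0)
  then have "L = s * L + p y * B" using L sums_unique2 by blast
  then have "L = p y * B / (1 - s)" using s by (simp add: field_simps)
  moreover have "p y * B = succ_prob p (xs @ [y])"
    using snoc.prems by (simp add: succ_prob_snoc B_def)
  ultimately show ?case using L by (simp add: s_def)
qed

lemma order_prob_le_succ_prob:
  assumes p: "\<And>x. p x > 0" "\<And>A. finite A \<Longrightarrow> sum p A < 1" and "distinct xs"
  shows "order_prob p k xs \<le> succ_prob p xs"
proof (cases xs rule: rev_cases)
  case Nil
  then show ?thesis by (cases k) (simp_all add: order_prob_0 order_prob_Suc_Nil)
next
  case (snoc ys y)
  have d: "distinct (ys @ [y])" using assms snoc by simp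
  have nn: "0 \<le> order_prob p k zs" for k zs
    by (intro order_prob_nonneg less_imp_le p(1))+
  have "order_prob p k (ys @ [y]) \<le> p y * (\<Sum>j<k. order_prob p j ys)"
  proof (induction k)
    case (Suc k)
    have "(\<Sum>x\<in>set (ys @ [y]). p x) * order_prob p k (ys @ [y]) \<le> 1 * order_prob p k (ys @ [y])"
      by (intro mult_right_mono nn less_imp_le p(2)) simp
    with Suc show ?case
      by (simp add: order_prob_Suc_snoc[OF d] distrib_left)
  qed (simp add: order_prob_0)
  also have "\<dots> \<le> p y * (succ_prob p ys / (1 - (\<Sum>x\<in>set ys. p x)))"
  proof (rule mult_left_mono)
    have "(\<lambda>k. order_prob p k ys) sums (succ_prob p ys / (1 - (\<Sum>x\<in>set ys. p x)))"
      by (rule sums_order_prob[OF p]) (use d in auto)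
    then show "(\<Sum>j<k. order_prob p j ys) \<le> succ_prob p ys / (1 - (\<Sum>x\<in>set ys. p x))"
      using sum_le_suminf[of "\<lambda>k. order_prob p k ys" "{..<k}"] nn by (simp add: sums_iff)
  qed (use p(1)[of y] in simp)
  finally show ?thesis using d by (simp add: succ_prob_snoc snoc mult.commute)
qed

lemma sum_lists_length_eq:
  fixes p :: "'b \<Rightarrow> real"
  assumes "finite A"
  shows "(\<Sum>l | set l \<subseteq> A \<and> length l = k. prod_list (map p l)) = (sum p A) ^ k"
proof (induction k)
  case 0
  have "{l. set l \<subseteq> A \<and> length l = 0} = {[]}" by auto
  then show ?case by simp
next
  case (Suc k)
  let ?L = "{l. set l \<subseteq> A \<and> length l = k}"
  have "{l. set l \<subseteq> A \<and> length l = Suc k} = (\<lambda>(x, l). x # l) ` (A \<times> ?L)"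
    by (auto simp: length_Suc_conv)
  then have "(\<Sum>l | set l \<subseteq> A \<and> length l = Suc k. prod_list (map p l)) =
      (\<Sum>z\<in>A \<times> ?L. p (fst z) * prod_list (map p (snd z)))"
    by (simp add: sum.reindex inj_on_def case_prod_unfold)
  also have "\<dots> = sum p A * (\<Sum>l\<in>?L. prod_list (map p l))"
    by (simp add: sum_product sum.cartesian_product case_prod_unfold)
  finally show ?case by (simp add: Suc)
qed

lemma sum_UN_le:
  fixes f :: "'b \<Rightarrow> real"
  assumes "finite I" "\<And>i. i \<in> I \<Longrightarrow> finite (B i)" "\<And>x. 0 \<le> f x"
  shows "sum f (\<Union>i\<in>I. B i) \<le> (\<Sum>i\<in>I. sum f (B i))"
  using assms(1,2)
proof (induction I rule: finite_induct)
  case (insert i I)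
  have "sum f (\<Union>i\<in>insert i I. B i) \<le> sum f (B i) + sum f (\<Union>i\<in>I. B i)"
    using insert assms(3) by (simp add: sum_Un sum_nonneg)
  with insert show ?case by force
qed simp

text \<open>The left-hand side is the probability that the elements of \<open>A\<close> appear before all other values. This
  happens if the first \<open>k\<close> samples lie in \<open>A\<close> and miss no element of \<open>A\<close>.\<close>

lemma sum_succ_prob_permutations_ge:
  assumes p: "\<And>x. p x > 0" "\<And>A. finite A \<Longrightarrow> sum p A < 1" and A: "finite A"
  shows "(\<Sum>xs\<in>permutations_of_set A. succ_prob p xs) \<ge>
    (sum p A) ^ k - (\<Sum>i\<in>A. (sum p A - p i) ^ k)"
proof -
  let ?L = "\<lambda>A. {l. set l \<subseteq> A \<and> length l = k}"
  let ?w = "\<lambda>l. prod_list (map p l)"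
  let ?C = "{l. set l = A \<and> length l = k}"
  have fin: "finite (?L B)" if "finite B" for B by (rule finite_lists_length_eq[OF that])
  have finC: "finite ?C" by (rule finite_subset[OF _ fin[OF A]]) auto
  have wnn: "0 \<le> ?w l" for l
    by (intro prod_list_nonneg) (auto intro: less_imp_le p(1))
  have "(sum p A) ^ k = sum ?w (?L A)" by (simp add: sum_lists_length_eq A)
  also have "\<dots> \<le> sum ?w (?C \<union> (\<Union>i\<in>A. ?L (A - {i})))"
    by (intro sum_mono2 wnn) (use fin finC A in auto)
  also have "\<dots> \<le> sum ?w ?C + sum ?w (\<Union>i\<in>A. ?L (A - {i}))"
    using finC fin A wnn by (subst sum_Un) (auto intro!: sum_nonneg)
  also have "sum ?w (\<Union>i\<in>A. ?L (A - {i})) \<le> (\<Sum>i\<in>A. sum ?w (?L (A - {i})))"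
    by (rule sum_UN_le) (use A fin wnn in auto)
  also have "\<dots> = (\<Sum>i\<in>A. (sum p A - p i) ^ k)"
    by (intro sum.cong refl, subst sum_lists_length_eq) (use A in \<open>auto simp: sum_diff1\<close>)
  also have "sum ?w ?C = (\<Sum>xs\<in>permutations_of_set A. order_prob p k xs)"
  proof -
    have "?C = (\<Union>xs\<in>permutations_of_set A. {l. length l = k \<and> appearance l = xs})"
      by (auto simp: permutations_of_set_def)
    then show ?thesis unfolding order_prob_def
      by (simp only:, intro sum.UNION_disjoint) auto
  qed
  also have "\<dots> \<le> (\<Sum>xs\<in>permutations_of_set A. succ_prob p xs)"
    by (intro sum_mono order_prob_le_succ_prob p) (auto simp: permutations_of_set_def)
  finally show ?thesis by simp
qed

section \<open>Conditionally i.i.d. samples\<close>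

text \<open>The bound on finite sums says that no finite set carries the whole mass of \<open>P\<close>.\<close>

locale conditionally_iid = prob_space M for M :: "'a measure" +
  fixes P :: "'a \<Rightarrow> nat \<Rightarrow> real" and X :: "'a \<Rightarrow> nat \<Rightarrow> nat"
  assumes iid: "cond_iid_given M P X"
    and P_pos: "\<And>\<omega> i. \<omega> \<in> space M \<Longrightarrow> 0 < P \<omega> i"
    and P_sum: "\<And>\<omega> A. \<omega> \<in> space M \<Longrightarrow> finite A \<Longrightarrow> sum (P \<omega>) A < 1"
begin

lemma measurable_P [measurable]: "(\<lambda>\<omega>. P \<omega> i) \<in> borel_measurable M"
proof -
  have "P \<in> measurable M (PiM UNIV (\<lambda>_. borel))" using iid by (simp add: cond_iid_given_def)
  then show ?thesis by (rule measurable_compose) simp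
qed

lemma measurable_X [measurable]: "(\<lambda>\<omega>. X \<omega> i) \<in> measurable M (count_space UNIV)"
proof -
  have "X \<in> measurable M seq_space" using iid by (simp add: cond_iid_given_def)
  then show ?thesis by (rule measurable_compose) simp
qed

lemma P_le_1: "\<omega> \<in> space M \<Longrightarrow> P \<omega> i \<le> 1"
  using P_sum[of \<omega> "{i}"] by simp

lemma emeasure_sample_prefix:
  "emeasure M {\<omega> \<in> space M. \<forall>j<n. X \<omega> j = x j} = (\<integral>\<^sup>+\<omega>. ennreal (\<Prod>j<n. P \<omega> (x j)) \<partial>M)"
proof -
  let ?A = "{\<omega> \<in> space M. \<forall>j<n. X \<omega> j = x j}"
  let ?F = "vimage_algebra (space M) P (PiM UNIV (\<lambda>_. borel))"
  have P: "P \<in> measurable M (PiM UNIV (\<lambda>_. borel))" using iid by (simp add: cond_iid_given_def)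
  have "subalgebra M ?F"
    using P measurable_sets[OF P] by (auto simp: subalgebra_def sets_vimage_algebra2 measurable_space)
  then interpret F: finite_measure_subalgebra M ?F
    by unfold_locales
  have [measurable]: "?A \<in> sets M" by measurable
  have "AE \<omega> in M. real_cond_exp M ?F (indicator ?A) \<omega> = (\<Prod>j<n. P \<omega> (x j))"
    using iid by (simp add: cond_iid_given_def)
  moreover have "integrable M (indicator ?A :: 'a \<Rightarrow> real)" by (simp add: emeasure_eq_measure)
  ultimately have "(\<integral>\<omega>. (\<Prod>j<n. P \<omega> (x j)) \<partial>M) = measure M ?A"
    using F.real_cond_exp_int(2)[of "indicator ?A"]
    by (subst integral_cong_AE[of _ _ "real_cond_exp M ?F (indicator ?A)"]) auto
  moreover have "integrable M (\<lambda>\<omega>. \<Prod>j<n. P \<omega> (x j))"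
  proof (rule integrable_const_bound[of _ 1])
    show "AE \<omega> in M. norm (\<Prod>j<n. P \<omega> (x j)) \<le> 1"
    proof (rule AE_I2)
      fix \<omega> assume "\<omega> \<in> space M"
      then show "norm (\<Prod>j<n. P \<omega> (x j)) \<le> 1"
        using P_pos[of \<omega>] P_le_1[of \<omega>]
        by (simp add: abs_prod abs_of_pos prod_le_1 less_imp_le)
    qed
  qed measurable
  ultimately show ?thesis
    using P_pos by (subst nn_integral_eq_integral)
      (auto intro!: AE_I2 prod_nonneg intro: less_imp_le simp: emeasure_eq_measure)
qed

lemma measurable_map_upt [measurable]:
  "(\<lambda>\<omega>. map (X \<omega>) [0..<k]) \<in> measurable M (count_space UNIV)"
proof -
  have "(\<lambda>\<omega>. map (X \<omega>) [0..<k]) -` {l} \<inter> space M \<in> sets M" for l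
    by (simp add: vimage_def map_upt_eq_iff Int_def conj_commute)
  then show ?thesis
    by (simp add: measurable_count_space_eq2_countable)
qed

lemma emeasure_sample_list:
  "emeasure M {\<omega> \<in> space M. map (X \<omega>) [0..<length l] = l} =
    (\<integral>\<^sup>+\<omega>. ennreal (prod_list (map (P \<omega>) l)) \<partial>M)"
  using emeasure_sample_prefix[of "length l" "\<lambda>j. l ! j"]
  by (simp add: map_upt_eq_iff prod.list_conv_set_nth atLeast0LessThan)

lemma emeasure_sample_lists:
  assumes "finite L" "\<And>l. l \<in> L \<Longrightarrow> length l = k"
  shows "emeasure M {\<omega> \<in> space M. map (X \<omega>) [0..<k] \<in> L} =
    (\<integral>\<^sup>+\<omega>. ennreal (\<Sum>l\<in>L. prod_list (map (P \<omega>) l)) \<partial>M)"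
proof -
  have "emeasure M {\<omega> \<in> space M. map (X \<omega>) [0..<k] \<in> L} =
      emeasure M (\<Union>l\<in>L. {\<omega> \<in> space M. map (X \<omega>) [0..<k] = l})"
    by (rule arg_cong[where f="emeasure M"]) auto
  also have "\<dots> = (\<Sum>l\<in>L. emeasure M {\<omega> \<in> space M. map (X \<omega>) [0..<k] = l})"
    by (rule sum_emeasure[symmetric]) (use assms in \<open>auto simp: disjoint_family_on_def\<close>)
  also have "\<dots> = (\<Sum>l\<in>L. \<integral>\<^sup>+\<omega>. ennreal (prod_list (map (P \<omega>) l)) \<partial>M)"
    using assms(2) emeasure_sample_list by (intro sum.cong) auto
  also have "\<dots> = (\<integral>\<^sup>+\<omega>. (\<Sum>l\<in>L. ennreal (prod_list (map (P \<omega>) l))) \<partial>M)"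
    by (subst nn_integral_sum) (auto simp: prod.list_conv_set_nth)
  also have "\<dots> = (\<integral>\<^sup>+\<omega>. ennreal (\<Sum>l\<in>L. prod_list (map (P \<omega>) l)) \<partial>M)"
    using P_pos by (intro nn_integral_cong sum_ennreal prod_list_nonneg) (auto intro: less_imp_le)
  finally show ?thesis .
qed

text \<open>The value \<open>i\<close> is missing from \<open>k\<close> samples with probability at most \<open>\<E>((1 - P i)\<^sup>k)\<close>. Only the probabilities of finite
  lists are at hand, so the other values are first restricted to \<open>{..<N}\<close>.\<close>

lemma AE_range_sample: "AE \<omega> in M. range (X \<omega>) = UNIV"
proof -
  have "AE \<omega> in M. \<exists>j. X \<omega> j = i" for i
  proof (rule AE_I')
    let ?N = "{\<omega> \<in> space M. \<forall>j. X \<omega> j \<noteq> i}"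
    have le: "emeasure M ?N \<le> (\<integral>\<^sup>+\<omega>. ennreal ((1 - P \<omega> i) ^ k) \<partial>M)" for k
    proof -
      let ?E = "\<lambda>N. {\<omega> \<in> space M. \<forall>j<k. X \<omega> j < N \<and> X \<omega> j \<noteq> i}"
      have E: "?E N \<in> sets M" for N by measurable
      have "emeasure M ?N \<le> emeasure M (\<Union>N. ?E N)"
      proof (rule emeasure_mono)
        show "?N \<subseteq> (\<Union>N. ?E N)"
        proof
          fix \<omega> assume "\<omega> \<in> ?N"
          moreover have "X \<omega> j < Suc (Max (X \<omega> ` {..<k}))" if "j < k" for j
            using that by (simp add: le_imp_less_Suc)
          ultimately have "\<omega> \<in> ?E (Suc (Max (X \<omega> ` {..<k})))" by blast
          then show "\<omega> \<in> (\<Union>N. ?E N)" by blast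
        qed
        show "(\<Union>N. ?E N) \<in> sets M" by (rule sets.countable_UN') (use E in auto)
      qed
      also have "\<dots> = (SUP N. emeasure M (?E N))"
      proof (rule SUP_emeasure_incseq[symmetric])
        show "range ?E \<subseteq> sets M" using E by blast
        show "incseq ?E" by (intro incseq_SucI) (auto simp: less_Suc_eq)
      qed
      also have "\<dots> \<le> (\<integral>\<^sup>+\<omega>. ennreal ((1 - P \<omega> i) ^ k) \<partial>M)"
      proof (rule SUP_least)
        fix N
        let ?A = "{..<N} - {i}"
        let ?L = "{l. set l \<subseteq> ?A \<and> length l = k}"
        have "?E N = {\<omega> \<in> space M. map (X \<omega>) [0..<k] \<in> ?L}"
          by (auto simp: image_subset_iff)
        moreover have "finite ?L" by (rule finite_lists_length_eq) simp
        ultimately have "emeasure M (?E N) =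
            (\<integral>\<^sup>+\<omega>. ennreal (\<Sum>l\<in>?L. prod_list (map (P \<omega>) l)) \<partial>M)"
          by (simp only:) (rule emeasure_sample_lists, simp_all)
        also have "\<dots> \<le> (\<integral>\<^sup>+\<omega>. ennreal ((1 - P \<omega> i) ^ k) \<partial>M)"
        proof (intro nn_integral_mono ennreal_leI)
          fix \<omega> assume \<omega>: "\<omega> \<in> space M"
          have "sum (P \<omega>) (insert i ?A) < 1" by (rule P_sum[OF \<omega>]) simp
          then have "sum (P \<omega>) ?A \<le> 1 - P \<omega> i" by (subst (asm) sum.insert) auto
          moreover have "0 \<le> sum (P \<omega>) ?A"
            using P_pos[OF \<omega>] by (simp add: sum_nonneg less_imp_le)
          ultimately show "(\<Sum>l\<in>?L. prod_list (map (P \<omega>) l)) \<le> (1 - P \<omega> i) ^ k"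
            by (subst sum_lists_length_eq) (simp_all add: power_mono)
        qed
        finally show "emeasure M (?E N) \<le> (\<integral>\<^sup>+\<omega>. ennreal ((1 - P \<omega> i) ^ k) \<partial>M)" .
      qed
      finally show ?thesis .
    qed
    have "(\<lambda>k. \<integral>\<^sup>+\<omega>. ennreal ((1 - P \<omega> i) ^ k) \<partial>M) \<longlonglongrightarrow> (\<integral>\<^sup>+\<omega>. 0 \<partial>M)"
    proof (rule nn_integral_dominated_convergence[where w = "\<lambda>_. 1"])
      show "AE \<omega> in M. (\<lambda>k. ennreal ((1 - P \<omega> i) ^ k)) \<longlonglongrightarrow> 0"
      proof (rule AE_I2)
        fix \<omega> assume \<omega>: "\<omega> \<in> space M"
        have "(\<lambda>k. (1 - P \<omega> i) ^ k) \<longlonglongrightarrow> 0"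
          using P_pos[OF \<omega>, of i] P_le_1[OF \<omega>, of i] by (intro LIMSEQ_power_zero) simp
        then show "(\<lambda>k. ennreal ((1 - P \<omega> i) ^ k)) \<longlonglongrightarrow> 0"
          using tendsto_ennrealI by fastforce
      qed
      show "AE \<omega> in M. ennreal ((1 - P \<omega> i) ^ k) \<le> 1" for k
        using P_pos P_le_1 by (intro AE_I2) (auto intro!: power_le_one intro: less_imp_le)
    qed (simp_all add: emeasure_space_1)
    then have "emeasure M ?N \<le> (\<integral>\<^sup>+\<omega>. 0 \<partial>M)"
      using le by (intro LIMSEQ_le_const) blast+
    then show "?N \<in> null_sets M" by (auto simp: null_sets_def)
  qed auto
  then have "AE \<omega> in M. \<forall>i. \<exists>j. X \<omega> j = i" by (simp add: AE_all_countable)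
  then show ?thesis by eventually_elim (auto intro: sym)
qed

lemma emeasure_distinct_values_prefix:
  assumes \<sigma>: "\<sigma> \<in> measurable M seq_space" "AE \<omega> in M. \<sigma> \<omega> = distinct_values (X \<omega>)"
    and "distinct xs"
  shows "emeasure M {\<omega> \<in> space M. map (\<sigma> \<omega>) [0..<length xs] = xs} =
    (\<integral>\<^sup>+\<omega>. ennreal (succ_prob (P \<omega>) xs) \<partial>M)"
proof (cases xs rule: rev_cases)
  case Nil
  then show ?thesis by (simp add: emeasure_space_1)
next
  case (snoc ys y)
  have d: "distinct ys" "y \<notin> set ys" using assms snoc by auto
  let ?E = "\<lambda>k. {\<omega> \<in> space M. appearance (map (X \<omega>) [0..<k]) = ys \<and> X \<omega> k = y}"
  have [measurable]: "?E k \<in> sets M" for k by measurable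
  have inf: "AE \<omega> in M. infinite (range (X \<omega>))"
    using AE_range_sample by eventually_elim simp
  have iff: "AE \<omega> in M. map (\<sigma> \<omega>) [0..<length xs] = xs \<longleftrightarrow> (\<exists>k. \<omega> \<in> ?E k)"
    using inf AE_space \<sigma>(2)
  proof eventually_elim
    case (elim \<omega>)
    show ?case using distinct_values_prefix_iff[OF elim(1) d(2)] elim(2,3) unfolding snoc by simp
  qed
  have "emeasure M (?E k) = (\<integral>\<^sup>+\<omega>. ennreal (order_prob (P \<omega>) k ys * P \<omega> y) \<partial>M)" for k
  proof -
    let ?L = "(\<lambda>l. l @ [y]) ` {l. length l = k \<and> appearance l = ys}"
    have "?E k = {\<omega> \<in> space M. map (X \<omega>) [0..<Suc k] \<in> ?L}"
      by (auto simp: image_iff)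
    moreover have "finite ?L" by simp
    ultimately have "emeasure M (?E k) =
        (\<integral>\<^sup>+\<omega>. ennreal (\<Sum>l\<in>?L. prod_list (map (P \<omega>) l)) \<partial>M)"
      by (simp only:) (rule emeasure_sample_lists, auto)
    then show ?thesis
      by (simp add: sum.reindex inj_on_def order_prob_def sum_distrib_right)
  qed
  note E = this
  have [measurable]: "(\<lambda>\<omega>. order_prob (P \<omega>) k ys) \<in> borel_measurable M" for k
    by (simp add: order_prob_def prod.list_conv_set_nth)
  have [measurable]: "(\<lambda>\<omega>. \<sigma> \<omega> i) \<in> measurable M (count_space UNIV)" for i
    using \<sigma>(1) by (rule measurable_compose) simp
  have "{\<omega> \<in> space M. map (\<sigma> \<omega>) [0..<length xs] = xs} \<in> sets M"
    by (simp add: map_upt_eq_iff)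
  then have "emeasure M {\<omega> \<in> space M. map (\<sigma> \<omega>) [0..<length xs] = xs} =
      emeasure M (\<Union>k. ?E k)"
    by (rule emeasure_eq_AE[rotated]) (use iff AE_space in auto)
  also have "\<dots> = (\<Sum>k. emeasure M (?E k))"
    using appearance_prefix_unique[OF _ _ d(2)]
    by (intro suminf_emeasure[symmetric]) (auto simp: disjoint_family_on_def)
  also have "\<dots> = (\<integral>\<^sup>+\<omega>. (\<Sum>k. ennreal (order_prob (P \<omega>) k ys * P \<omega> y)) \<partial>M)"
    unfolding E by (subst nn_integral_suminf) auto
  also have "\<dots> = (\<integral>\<^sup>+\<omega>. ennreal (succ_prob (P \<omega>) xs) \<partial>M)"
  proof (rule nn_integral_cong)
    fix \<omega> assume \<omega>: "\<omega> \<in> space M"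
    have "(\<lambda>k. order_prob (P \<omega>) k ys) sums (succ_prob (P \<omega>) ys / (1 - sum (P \<omega>) (set ys)))"
      using P_pos[OF \<omega>] P_sum[OF \<omega>] d(1) by (rule sums_order_prob)
    from sums_mult2[OF this, of "P \<omega> y"]
    have "(\<lambda>k. order_prob (P \<omega>) k ys * P \<omega> y) sums succ_prob (P \<omega>) xs"
      using d by (simp add: snoc succ_prob_snoc)
    moreover have "0 \<le> order_prob (P \<omega>) k ys * P \<omega> y" for k
      using P_pos[OF \<omega>] by (intro mult_nonneg_nonneg order_prob_nonneg) (auto intro: less_imp_le)
    ultimately show "(\<Sum>k. ennreal (order_prob (P \<omega>) k ys * P \<omega> y)) = ennreal (succ_prob (P \<omega>) xs)"
      by (intro suminf_ennreal_eq)
  qed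
  finally show ?thesis .
qed

end

section \<open>Stick-breaking weights\<close>

text \<open>The stick is broken at the proportion \<open>w i\<close> of what remains after the first \<open>i\<close> pieces.\<close>

definition stick :: "(nat \<Rightarrow> real) \<Rightarrow> nat \<Rightarrow> real" where
  "stick w i = (\<Prod>j<i. 1 - w j) * w i"

lemma sum_stick: "(\<Sum>i<n. stick w i) = 1 - (\<Prod>j<n. 1 - w j)"
  by (induction n) (simp_all add: stick_def algebra_simps)

lemma stick_pos: "(\<And>i. 0 < w i \<and> w i < 1) \<Longrightarrow> 0 < stick w i"
  by (simp add: stick_def prod_pos)

lemma sum_stick_less_1:
  assumes "\<And>i. 0 < w i \<and> w i < 1" "finite A"
  shows "sum (stick w) A < 1"
proof -
  obtain n where "A \<subseteq> {..<n}" using assms(2) finite_nat_bounded by blast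
  then have "sum (stick w) A \<le> (\<Sum>i<n. stick w i)"
    using stick_pos[of w] assms(1) by (intro sum_mono2) (auto intro: less_imp_le)
  also have "\<dots> < 1" using assms(1) by (simp add: sum_stick prod_pos)
  finally show ?thesis .
qed

lemma stick_comb_seq_less: "i < n \<Longrightarrow> stick (comb_seq n w w') i = stick w i"
  by (simp add: stick_def comb_seq_less)

lemma prod_lessThan_add:
  "prod f {..<n + m :: nat} = prod f {..<n} * (\<Prod>i<m. f (n + i))" for f :: "nat \<Rightarrow> 'b::comm_monoid_mult"
  by (induction m) (simp_all add: mult.assoc)

lemma stick_comb_seq_add:
  "stick (comb_seq n w w') (n + i) = (\<Prod>j<n. 1 - w j) * stick w' i"
  by (simp add: stick_def comb_seq_def prod_lessThan_add mult.assoc)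

lemma succ_prob_cong:
  assumes "\<And>x. x \<in> set xs \<Longrightarrow> p x = p' x"
  shows "succ_prob p xs = succ_prob p' xs"
proof -
  have "p (xs ! i) = p' (xs ! i)" if "i < length xs" for i using assms that by simp
  then show ?thesis unfolding succ_prob_def by simp
qed

lemma succ_prob_append:
  assumes "distinct xs"
  shows "succ_prob p (xs @ ys) = succ_prob p xs *
    (\<Prod>i<length ys. p (ys ! i) / (1 - sum p (set xs) - (\<Sum>l<i. p (ys ! l))))"
proof -
  have sum_add: "sum f {..<n + m} = sum f {..<n} + (\<Sum>i<m. f (n + i))" for f :: "nat \<Rightarrow> real" and n m
    by (induction m) (simp_all add: add.assoc)
  show ?thesis
    unfolding succ_prob_def length_append prod_lessThan_add
    by (simp add: nth_append sum_add sum_nth_eq_sum_set[OF assms] diff_diff_eq)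
qed

text \<open>The weights from \<open>n\<close> on are those of the shifted factors \<open>w'\<close>, scaled by the remaining length \<open>?S\<close>;
  after the values \<open>{..<n}\<close> have been seen, the denominators carry the same scaling factor.\<close>

lemma succ_prob_comb_seq:
  assumes w: "\<And>i. 0 < w i \<and> w i < 1" and xs: "xs \<in> permutations_of_set {..<n}"
  shows "succ_prob (stick (comb_seq n w w')) (xs @ map ((+) n) ys) =
    succ_prob (stick w) xs * succ_prob (stick w') ys"
proof -
  have xs': "set xs = {..<n}" "distinct xs" using xs by (auto simp: permutations_of_set_def)
  let ?S = "\<Prod>j<n. 1 - w j"
  have S: "?S \<noteq> 0" using w by (simp add: prod_pos less_imp_neq[symmetric])
  have "1 - sum (stick (comb_seq n w w')) (set xs) = ?S"
    by (simp add: xs' stick_comb_seq_less sum_stick cong: sum.cong_simp)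
  moreover have "(\<Sum>l<i. stick (comb_seq n w w') (map ((+) n) ys ! l)) =
      ?S * (\<Sum>l<i. stick w' (ys ! l))" if "i < length ys" for i
    using that unfolding sum_distrib_left by (intro sum.cong) (auto simp: stick_comb_seq_add)
  ultimately have "succ_prob (stick (comb_seq n w w')) (xs @ map ((+) n) ys) =
      succ_prob (stick (comb_seq n w w')) xs *
      (\<Prod>i<length ys. ?S * stick w' (ys ! i) / (?S - ?S * (\<Sum>l<i. stick w' (ys ! l))))"
    unfolding succ_prob_append[OF xs'(2)] by (simp add: stick_comb_seq_add)
  also have "succ_prob (stick (comb_seq n w w')) xs = succ_prob (stick w) xs"
    by (rule succ_prob_cong) (simp add: xs' stick_comb_seq_less)
  also have "(\<Prod>i<length ys. ?S * stick w' (ys ! i) / (?S - ?S * (\<Sum>l<i. stick w' (ys ! l)))) =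
      succ_prob (stick w') ys"
    unfolding succ_prob_def
  proof (rule prod.cong)
    fix i
    have "?S - ?S * (\<Sum>l<i. stick w' (ys ! l)) = ?S * (1 - (\<Sum>l<i. stick w' (ys ! l)))"
      by (simp add: right_diff_distrib)
    then show "?S * stick w' (ys ! i) / (?S - ?S * (\<Sum>l<i. stick w' (ys ! l))) =
        stick w' (ys ! i) / (1 - (\<Sum>l<i. stick w' (ys ! l)))"
      using S by simp
  qed simp
  finally show ?thesis .
qed

text \<open>\<open>D\<close> is the law of a single factor, and \<open>S\<close> the law of an i.i.d. sequence of factors.\<close>

locale stick_breaking_law = prob_space D for D :: "real measure" +
  assumes sets_D [measurable_cong]: "sets D = sets borel"
    and AE_D: "AE w in D. 0 < w \<and> w < 1"
begin

sublocale sequence_space D ..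

text \<open>The probability that a \<open>P\<close>-biased permutation with i.i.d. stick-breaking factors starts with \<open>xs\<close>.\<close>

definition mean_succ_prob :: "nat list \<Rightarrow> ennreal" where
  "mean_succ_prob xs = (\<integral>\<^sup>+w. ennreal (succ_prob (stick w) xs) \<partial>S)"

lemma measurable_succ_prob [measurable]: "(\<lambda>w. succ_prob (stick w) xs) \<in> borel_measurable S"
  unfolding succ_prob_def stick_def by measurable

lemma AE_S: "AE w in S. \<forall>i. 0 < w i \<and> w i < 1"
  unfolding AE_all_countable by (intro allI AE_component[OF UNIV_I AE_D])

text \<open>Under the product law the factors before and after \<open>n\<close> are independent, and those after \<open>n\<close> form
  again an i.i.d. sequence.\<close>

lemma mean_succ_prob_append:
  assumes xs: "xs \<in> permutations_of_set {..<n}" and ys: "distinct ys"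
  shows "mean_succ_prob (xs @ map ((+) n) ys) = mean_succ_prob xs * mean_succ_prob ys"
proof -
  let ?f = "\<lambda>w. ennreal (succ_prob (stick w) (xs @ map ((+) n) ys))"
  have S: "sigma_finite_measure S" ..
  have "mean_succ_prob (xs @ map ((+) n) ys) =
      (\<integral>\<^sup>+w. ?f w \<partial>distr (S \<Otimes>\<^sub>M S) S (\<lambda>(w, w'). comb_seq n w w'))"
    by (simp add: mean_succ_prob_def PiM_comb_seq)
  also have "\<dots> = (\<integral>\<^sup>+z. ?f (comb_seq n (fst z) (snd z)) \<partial>(S \<Otimes>\<^sub>M S))"
    by (subst nn_integral_distr) (auto simp: case_prod_unfold intro!: measurable_comb_seq')
  also have "\<dots> = (\<integral>\<^sup>+w. \<integral>\<^sup>+w'. ?f (comb_seq n w w') \<partial>S \<partial>S)"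
    using sigma_finite_measure.nn_integral_fst[OF S, of "\<lambda>z. ?f (comb_seq n (fst z) (snd z))"] by simp
  also have "\<dots> = (\<integral>\<^sup>+w. ennreal (succ_prob (stick w) xs) * mean_succ_prob ys \<partial>S)"
  proof (rule nn_integral_cong_AE)
    show "AE w in S. (\<integral>\<^sup>+w'. ?f (comb_seq n w w') \<partial>S) =
        ennreal (succ_prob (stick w) xs) * mean_succ_prob ys"
      using AE_S
    proof eventually_elim
      case (elim w)
      have "succ_prob (stick w) xs \<ge> 0"
        using elim xs by (intro succ_prob_nonneg stick_pos sum_stick_less_1)
          (auto simp: permutations_of_set_def)
      then show ?case
        unfolding mean_succ_prob_def succ_prob_comb_seq[OF elim[rule_format] xs]
        by (simp add: ennreal_mult' nn_integral_cmult)
    qed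
  qed
  also have "\<dots> = mean_succ_prob xs * mean_succ_prob ys"
    by (simp add: nn_integral_multc mean_succ_prob_def)
  finally show ?thesis .
qed

end

lemma (in prob_space) distr_iid_sequence:
  assumes "indep_vars (\<lambda>_. borel) Ws UNIV" "\<And>i. distr M borel (Ws i) = D"
  shows "distr M (PiM UNIV (\<lambda>_. borel)) (\<lambda>\<omega> i. Ws i \<omega>) = PiM UNIV (\<lambda>_ :: nat. D)"
proof -
  have "\<And>i. Ws i \<in> borel_measurable M" using assms(1) by (auto simp: indep_vars_def)
  then show ?thesis
    using indep_vars_iff_distr_eq_PiM[where I = UNIV and M' = "\<lambda>_. borel" and X = Ws] assms by (simp add: restrict_def)
qed

section \<open>Cylinders in sequence space\<close>

text \<open>The sequences that start with the list \<open>l\<close>. For countably many values they form a generator of the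
  product sigma-algebra that is closed under intersection up to the empty set.\<close>

definition cylinder :: "'b list \<Rightarrow> (nat \<Rightarrow> 'b) set" where
  "cylinder l = {x. map x [0..<length l] = l}"

lemma space_seq_space [simp]: "space seq_space = UNIV"
  by (simp add: space_PiM)

lemma mem_cylinder_iff: "x \<in> cylinder l \<longleftrightarrow> (\<forall>j<length l. x j = l ! j)"
  by (simp add: cylinder_def map_upt_eq_iff)

lemma cylinder_in_sets [measurable]: "cylinder l \<in> sets seq_space"
proof -
  have "cylinder l = {x \<in> space seq_space. \<forall>j<length l. x j = l ! j}"
    by (auto simp: mem_cylinder_iff)
  also have "\<dots> \<in> sets seq_space" by measurable
  finally show ?thesis .
qed

lemma cylinder_Int:
  "cylinder l \<inter> cylinder l' = {} \<or> cylinder l \<inter> cylinder l' = cylinder l \<or>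
    cylinder l \<inter> cylinder l' = cylinder l'"
proof -
  have *: "cylinder l \<inter> cylinder l' = {} \<or> cylinder l \<inter> cylinder l' = cylinder l'"
    if "length l \<le> length l'" for l l' :: "'a list"
  proof (cases "\<forall>j<length l. l' ! j = l ! j")
    case True
    with that have "cylinder l' \<subseteq> cylinder l" by (auto simp: mem_cylinder_iff)
    then show ?thesis by blast
  next
    case False
    then obtain j where "j < length l" "l' ! j \<noteq> l ! j" by blast
    with that show ?thesis by (force simp: mem_cylinder_iff disjoint_iff)
  qed
  show ?thesis using *[of l l'] *[of l' l] linear[of "length l" "length l'"] by (auto simp: Int_commute)
qed

lemma sets_seq_space_eq_cylinders:
  "sets (seq_space :: (nat \<Rightarrow> 'b::countable) measure) = sigma_sets UNIV (range cylinder)"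
proof
  show "sigma_sets UNIV (range cylinder) \<subseteq> sets (seq_space :: (nat \<Rightarrow> 'b) measure)"
  proof -
    have "range cylinder \<subseteq> sets (seq_space :: (nat \<Rightarrow> 'b) measure)" using cylinder_in_sets by blast
    from sets.sigma_sets_subset[OF this] show ?thesis by simp
  qed
  let ?\<Sigma> = "sigma UNIV (range (cylinder :: 'b list \<Rightarrow> _))"
  have "(\<lambda>x. x i) \<in> measurable ?\<Sigma> (count_space UNIV)" for i :: nat
  proof -
    have "(\<lambda>x. x i) -` {b} \<inter> space ?\<Sigma> \<in> sets ?\<Sigma>" for b :: 'b
    proof -
      have "(\<lambda>x. x i) -` {b} \<inter> space ?\<Sigma> = (\<Union>l\<in>{l. length l = Suc i \<and> l ! i = b}. cylinder l)"
      proof (intro set_eqI iffI)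
        fix x assume "x \<in> (\<lambda>x. x i) -` {b} \<inter> space ?\<Sigma>"
        then have "map x [0..<Suc i] ! i = b" by (simp del: upt_Suc)
        moreover have "x \<in> cylinder (map x [0..<Suc i])"
          by (simp add: mem_cylinder_iff del: upt_Suc)
        ultimately show "x \<in> (\<Union>l\<in>{l. length l = Suc i \<and> l ! i = b}. cylinder l)"
          by (intro UN_I[of "map x [0..<Suc i]"]) simp_all
      qed (auto simp: mem_cylinder_iff)
      also have "\<dots> \<in> sets ?\<Sigma>"
        by (rule sets.countable_UN'') (auto intro: sigma_sets.Basic)
      finally show ?thesis .
    qed
    then show ?thesis by (simp add: measurable_count_space_eq2_countable)
  qed
  then have "(\<lambda>x. x) \<in> measurable ?\<Sigma> (seq_space :: (nat \<Rightarrow> 'b) measure)"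
    by (intro measurable_PiM_single') (auto simp: space_PiM)
  then show "sets (seq_space :: (nat \<Rightarrow> 'b) measure) \<subseteq> sigma_sets UNIV (range cylinder)"
    using measurable_sets[of "\<lambda>x. x" ?\<Sigma> "seq_space :: (nat \<Rightarrow> 'b) measure"] by auto
qed

lemma seq_space_measure_eqI:
  fixes N :: "(nat \<Rightarrow> 'b::countable) measure"
  assumes sets: "sets N = sets seq_space" "sets N' = sets seq_space"
    and fin: "emeasure N UNIV \<noteq> \<infinity>"
    and eq: "\<And>l. emeasure N (cylinder l) = emeasure N' (cylinder l)"
  shows "N = N'"
proof (rule measure_eqI_generator_eq[where E = "insert {} (range cylinder)" and A = "\<lambda>_. cylinder []"
      and \<Omega> = UNIV])
  show "Int_stable (insert {} (range (cylinder :: 'b list \<Rightarrow> _)))"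
    unfolding Int_stable_def using cylinder_Int by blast
  have "sigma_sets UNIV (insert {} (range (cylinder :: 'b list \<Rightarrow> _))) = sigma_sets UNIV (range cylinder)"
    by (intro sigma_sets_eqI) (auto intro: sigma_sets.Empty)
  then show "sets N = sigma_sets UNIV (insert {} (range cylinder))"
    "sets N' = sigma_sets UNIV (insert {} (range cylinder))"
    using sets by (simp_all add: sets_seq_space_eq_cylinders)
  have "cylinder [] = (UNIV :: (nat \<Rightarrow> 'b) set)" by (auto simp: mem_cylinder_iff)
  then show "(\<Union>i::nat. cylinder []) = (UNIV :: (nat \<Rightarrow> 'b) set)" "emeasure N (cylinder []) \<noteq> \<infinity>"
    using fin by auto
qed (use eq in auto)

section \<open>Shifts and splitting times\<close>

text \<open>The permutation \<open>\<pi>\<^sup>n\<close> seen from a splitting time \<open>n\<close>. If \<open>\<pi>\<close> is injective and splits at \<open>n\<close>, the natural subtraction is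
  never truncated (\<open>splits_at_ge\<close>).\<close>

definition shift_seq :: "nat \<Rightarrow> (nat \<Rightarrow> nat) \<Rightarrow> nat \<Rightarrow> nat" where
  "shift_seq n \<pi> i = \<pi> (n + i) - n"

lemma measurable_shift_seq [measurable]: "shift_seq n \<in> measurable seq_space seq_space"
  unfolding shift_seq_def by (rule measurable_PiM_single') (auto simp: space_PiM)

lemma splits_at_iff_permutation: "splits_at \<pi> n \<longleftrightarrow> map \<pi> [0..<n] \<in> permutations_of_set {..<n}"
proof
  assume *: "splits_at \<pi> n"
  then have "set (map \<pi> [0..<n]) = {..<n}" by (simp add: splits_at_def atLeast0LessThan)
  moreover from this have "distinct (map \<pi> [0..<n])" by (intro card_distinct) simp
  ultimately show "map \<pi> [0..<n] \<in> permutations_of_set {..<n}" by (simp add: permutations_of_set_def)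
qed (auto simp: permutations_of_set_def splits_at_def atLeast0LessThan)

lemma splits_at_ge:
  assumes "splits_at \<pi> n" "inj \<pi>"
  shows "n \<le> \<pi> (n + i)"
proof (rule ccontr)
  assume "\<not> n \<le> \<pi> (n + i)"
  then have "\<pi> (n + i) \<in> \<pi> ` {..<n}" using assms(1) by (simp add: splits_at_def)
  then show False using assms(2) by (auto simp: inj_on_def)
qed

lemma shift_seq_eq_iff:
  assumes "splits_at \<pi> n" "inj \<pi>"
  shows "shift_seq n \<pi> i = y \<longleftrightarrow> \<pi> (n + i) = n + y"
  using splits_at_ge[OF assms, of i] by (auto simp: shift_seq_def)

lemma inj_shift_seq:
  assumes "splits_at \<pi> n" "inj \<pi>"
  shows "inj (shift_seq n \<pi>)"
proof (rule injI)
  fix i j assume "shift_seq n \<pi> i = shift_seq n \<pi> j"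
  then have "\<pi> (n + i) = \<pi> (n + j)" using splits_at_ge[OF assms] by (simp add: shift_seq_def eq_diff_iff)
  with assms(2) show "i = j" by (simp add: inj_eq)
qed

lemma splits_at_shift_seq:
  assumes "splits_at \<pi> n" "inj \<pi>"
  shows "splits_at (shift_seq n \<pi>) m \<longleftrightarrow> splits_at \<pi> (n + m)"
proof -
  have "{..<n + m} = {..<n} \<union> (+) n ` {..<m}"
  proof (intro set_eqI iffI)
    fix i assume i: "i \<in> {..<n + m}"
    show "i \<in> {..<n} \<union> (+) n ` {..<m}"
    proof (cases "i < n")
      case False
      with i show ?thesis by (intro UnI2 image_eqI[of _ _ "i - n"]) auto
    qed simp
  qed auto
  then have un: "\<pi> ` {..<n + m} = {..<n} \<union> (+) n ` shift_seq n \<pi> ` {..<m}"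
    using assms splits_at_ge[OF assms] by (simp add: image_Un image_image splits_at_def shift_seq_def)
  show ?thesis
    unfolding splits_at_def un
    unfolding \<open>{..<n + m} = _\<close>
  proof
    assume *: "{..<n} \<union> (+) n ` shift_seq n \<pi> ` {..<m} = {..<n} \<union> (+) n ` {..<m}"
    have "(+) n ` A = ({..<n} \<union> (+) n ` A) - {..<n}" for A :: "nat set" by auto
    then have "(+) n ` shift_seq n \<pi> ` {..<m} = (+) n ` {..<m}" by (metis *)
    then show "shift_seq n \<pi> ` {..<m} = {..<m}" by (simp add: inj_image_eq_iff)
  qed simp
qed

lemma splitting_time_Suc:
  "splitting_time \<pi> (Suc k) = (if \<exists>n. splitting_time \<pi> k < enat n \<and> splits_at \<pi> n
     then enat (LEAST n. splitting_time \<pi> k < enat n \<and> splits_at \<pi> n) else \<infinity>)"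
proof -
  let ?P = "\<lambda>n. splitting_time \<pi> k < enat n \<and> splits_at \<pi> n"
  show ?thesis
  proof (cases "\<exists>n. ?P n")
    case True
    then have "?P (LEAST n. ?P n)" by (rule LeastI_ex)
    then have "Inf {enat n | n. ?P n} = enat (LEAST n. ?P n)"
      by (intro antisym Inf_lower Inf_greatest) (auto intro: Least_le)
    then show ?thesis using True by simp
  next
    case False
    then have "{enat n | n. ?P n} = {}" by blast
    then have "Inf {enat n | n. ?P n} = \<infinity>" by (simp only: Inf_empty top_enat_def)
    with False show ?thesis by auto
  qed
qed

declare splitting_time.simps(2) [simp del]

lemma splitting_time_Suc_eq_enatD:
  "splitting_time \<pi> (Suc k) = enat n \<Longrightarrow> splitting_time \<pi> k < enat n \<and> splits_at \<pi> n"
  unfolding splitting_time_Suc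
  using LeastI_ex[of "\<lambda>n. splitting_time \<pi> k < enat n \<and> splits_at \<pi> n"]
  by (auto split: if_splits)

lemma splitting_time_le:
  "splitting_time \<pi> k < enat n \<Longrightarrow> splits_at \<pi> n \<Longrightarrow> splitting_time \<pi> (Suc k) \<le> enat n"
  unfolding splitting_time_Suc by (auto intro: Least_le)

lemma splits_at_splitting_time: "splitting_time \<pi> k = enat n \<Longrightarrow> splits_at \<pi> n"
proof (cases k)
  case 0
  moreover assume "splitting_time \<pi> k = enat n"
  ultimately show ?thesis by (simp add: splits_at_def zero_enat_def)
next
  case (Suc j)
  moreover assume "splitting_time \<pi> k = enat n"
  ultimately show ?thesis using splitting_time_Suc_eq_enatD by blast
qed

lemma splitting_time_less_Suc:
  "splitting_time \<pi> k \<noteq> \<infinity> \<Longrightarrow> splitting_time \<pi> k < splitting_time \<pi> (Suc k)"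
  using splitting_time_Suc_eq_enatD[of \<pi> k] by (cases "splitting_time \<pi> (Suc k)") (auto)

lemma splitting_time_mono: "i \<le> j \<Longrightarrow> splitting_time \<pi> i \<le> splitting_time \<pi> j"
proof (induction rule: dec_induct)
  case (step j)
  have "splitting_time \<pi> j \<le> splitting_time \<pi> (Suc j)"
    using splitting_time_less_Suc[of \<pi> j]
    by (cases "splitting_time \<pi> j = \<infinity>") (auto simp: splitting_time_Suc)
  with step show ?case by (meson order_trans)
qed simp

lemma splitting_time_strict_mono:
  assumes "i < j" "splitting_time \<pi> i \<noteq> \<infinity>"
  shows "splitting_time \<pi> i < splitting_time \<pi> j"
  using splitting_time_less_Suc[OF assms(2)] splitting_time_mono[of "Suc i" j \<pi>] assms(1)
  by simp

lemma splitting_time_ge: "enat k \<le> splitting_time \<pi> k"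
proof (induction k)
  case (Suc k)
  show ?case
  proof (cases "splitting_time \<pi> k = \<infinity>")
    case False
    then have "enat k < splitting_time \<pi> (Suc k)"
      using Suc splitting_time_less_Suc[of \<pi> k] by simp
    then show ?thesis by (simp add: eSuc_enat[symmetric] ileI1)
  qed (simp add: splitting_time_Suc)
qed (simp add: zero_enat_def)

text \<open>Time \<open>0\<close> and the positive splitting times are enumerated without repetition.\<close>

lemma renewal_indicator_splitting_time:
  "renewal_indicator (splitting_time \<pi>) n = of_bool (splits_at \<pi> n)"
proof (cases "splits_at \<pi> n")
  case True
  have "\<exists>k. splitting_time \<pi> k = enat n"
  proof (rule ccontr)
    assume *: "\<nexists>k. splitting_time \<pi> k = enat n"
    have lt: "splitting_time \<pi> k < enat n" for k
    proof (induction k)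
      case 0
      show ?case using *[simplified, rule_format, of 0] by (simp add: zero_enat_def)
    next
      case (Suc k)
      then have "splitting_time \<pi> (Suc k) \<le> enat n" using True by (rule splitting_time_le)
      then show ?case using * by (auto simp: order_less_le)
    qed
    show False using splitting_time_ge[of n \<pi>] lt[of n] by simp
  qed
  then obtain k where k: "splitting_time \<pi> k = enat n" ..
  have "{j. splitting_time \<pi> j = enat n} = {k}"
  proof (intro equalityI subsetI)
    fix j assume "j \<in> {j. splitting_time \<pi> j = enat n}"
    then show "j \<in> {k}"
      using k splitting_time_strict_mono[of j k \<pi>] splitting_time_strict_mono[of k j \<pi>]
      by (cases j k rule: linorder_cases) auto
  qed (use k in simp)
  then show ?thesis using True by (simp add: renewal_indicator_def)
next
  case False
  then have "{j. splitting_time \<pi> j = enat n} = {}" using splits_at_splitting_time by blast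
  then show ?thesis using False by (simp add: renewal_indicator_def)
qed

text \<open>The splitting times after the first one are those of the shifted permutation.\<close>

lemma splitting_time_shift_seq:
  assumes "inj \<pi>" "splitting_time \<pi> 1 = enat n"
  shows "splitting_time \<pi> (Suc k) = enat n + splitting_time (shift_seq n \<pi>) k"
proof (induction k)
  case 0
  then show ?case using assms(2) by simp
next
  case (Suc k)
  have sp: "splits_at \<pi> n" using assms(2) by (rule splits_at_splitting_time)
  let ?A = "{enat m | m. splitting_time (shift_seq n \<pi>) k < enat m \<and> splits_at (shift_seq n \<pi>) m}"
  have "{enat m | m. splitting_time \<pi> (Suc k) < enat m \<and> splits_at \<pi> m} = (+) (enat n) ` ?A"
    (is "?B = _")
  proof (intro equalityI subsetI)
    fix x assume "x \<in> ?B"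
    then obtain m where m: "x = enat m" "splitting_time \<pi> (Suc k) < enat m" "splits_at \<pi> m" by blast
    then have lt: "enat n + splitting_time (shift_seq n \<pi>) k < enat m" by (simp only: Suc)
    then have "n \<le> m" by (cases "splitting_time (shift_seq n \<pi>) k") auto
    then obtain m' where m': "m = n + m'" using le_Suc_ex by blast
    then have "enat m' \<in> ?A"
      using lt m(3) splits_at_shift_seq[OF sp assms(1), of m']
      by (cases "splitting_time (shift_seq n \<pi>) k") auto
    then show "x \<in> (+) (enat n) ` ?A" using m m' by (intro image_eqI[of _ _ "enat m'"]) auto
  next
    fix x assume "x \<in> (+) (enat n) ` ?A"
    then obtain m where "x = enat (n + m)" "splitting_time (shift_seq n \<pi>) k < enat m"
      "splits_at (shift_seq n \<pi>) m" by auto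
    then show "x \<in> ?B"
      unfolding Suc using splits_at_shift_seq[OF sp assms(1), of m]
      by (cases "splitting_time (shift_seq n \<pi>) k") auto
  qed
  moreover have "Inf ((+) (enat n) ` ?A) = enat n + Inf ?A"
  proof (cases "?A = {}")
    case False
    then have "Inf ?A \<in> ?A" by (metis (no_types, lifting) Inf_enat_def LeastI_ex ex_in_conv)
    then show ?thesis
      by (intro antisym Inf_lower Inf_greatest) (auto intro: add_left_mono Inf_lower)
  qed (simp only: image_empty Inf_empty top_enat_def, simp)
  ultimately show ?case by (simp only: splitting_time.simps(2))
qed

lemma splitting_time_1_gt_iff:
  "enat n < splitting_time \<pi> 1 \<longleftrightarrow> (\<forall>j\<in>{1..n}. \<not> splits_at \<pi> j)"
proof
  assume *: "enat n < splitting_time \<pi> 1"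
  show "\<forall>j\<in>{1..n}. \<not> splits_at \<pi> j"
  proof (intro ballI notI)
    fix j assume j: "j \<in> {1..n}" "splits_at \<pi> j"
    then have "splitting_time \<pi> (Suc 0) \<le> enat j" by (intro splitting_time_le) (auto simp: zero_enat_def)
    with * j(1) show False by (cases "splitting_time \<pi> 1") (auto)
  qed
next
  assume *: "\<forall>j\<in>{1..n}. \<not> splits_at \<pi> j"
  show "enat n < splitting_time \<pi> 1"
  proof (cases "splitting_time \<pi> 1")
    case (enat m)
    then have "0 < m" "splits_at \<pi> m" using splitting_time_Suc_eq_enatD[of \<pi> 0 m]
      by (auto simp: zero_enat_def)
    have "\<not> m \<le> n"
    proof
      assume "m \<le> n"
      with \<open>0 < m\<close> have "m \<in> {1..n}" by simp
      with * \<open>splits_at \<pi> m\<close> show False by blast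
    qed
    with enat show ?thesis by (simp only: enat_ord_simps not_le)
  qed (simp)
qed

lemma measurable_splits_at [measurable]: "Measurable.pred seq_space (\<lambda>\<pi>. splits_at \<pi> n)"
proof -
  have "splits_at \<pi> n \<longleftrightarrow> (\<forall>i<n. \<pi> i < n) \<and> (\<forall>j<n. \<exists>i<n. \<pi> i = j)" for \<pi>
  proof -
    have "splits_at \<pi> n \<longleftrightarrow> \<pi> ` {..<n} \<subseteq> {..<n} \<and> {..<n} \<subseteq> \<pi> ` {..<n}"
      by (auto simp: splits_at_def)
    also have "\<dots> \<longleftrightarrow> (\<forall>i<n. \<pi> i < n) \<and> (\<forall>j<n. \<exists>i<n. \<pi> i = j)"
      unfolding image_subset_iff subset_iff image_iff lessThan_iff Bex_def Ball_def by metis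
    finally show ?thesis .
  qed
  then show ?thesis by simp
qed

lemma measurable_splitting_time_nth [measurable]:
  "(\<lambda>\<pi>. splitting_time \<pi> k) \<in> measurable seq_space (count_space UNIV)"
proof (induction k)
  case (Suc k)
  note [measurable] = Suc
  show ?case unfolding splitting_time_Suc by measurable
qed simp

lemma measurable_splitting_time [measurable]:
  "splitting_time \<in> measurable seq_space seq_space"
  by (rule measurable_PiM_single') (auto simp: space_PiM)

section \<open>Regeneration of a factorizing permutation\<close>

lemma splits_at_iff_take:
  assumes "j \<le> n"
  shows "splits_at \<pi> j \<longleftrightarrow> set (take j (map \<pi> [0..<n])) = {..<j}"
  using assms by (simp add: splits_at_def take_map take_upt atLeast0LessThan)

lemma splitting_time_1_eq_iff:
  "splitting_time \<pi> 1 = enat n \<longleftrightarrow>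
    n > 0 \<and> splits_at \<pi> n \<and> (\<forall>j\<in>{1..<n}. set (take j (map \<pi> [0..<n])) \<noteq> {..<j})"
proof -
  have "splitting_time \<pi> 1 = enat n \<longleftrightarrow> n > 0 \<and> splits_at \<pi> n \<and> enat (n - 1) < splitting_time \<pi> 1"
  proof
    assume "splitting_time \<pi> 1 = enat n"
    then show "n > 0 \<and> splits_at \<pi> n \<and> enat (n - 1) < splitting_time \<pi> 1"
      using splitting_time_Suc_eq_enatD[of \<pi> 0 n]
      by (auto simp: zero_enat_def)
  next
    assume *: "n > 0 \<and> splits_at \<pi> n \<and> enat (n - 1) < splitting_time \<pi> 1"
    then have "splitting_time \<pi> (Suc 0) \<le> enat n"
      by (intro splitting_time_le) (auto simp: zero_enat_def)
    then show "splitting_time \<pi> 1 = enat n"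
      using * by (cases "splitting_time \<pi> 1") (auto)
  qed
  moreover have "enat (n - 1) < splitting_time \<pi> 1 \<longleftrightarrow>
      (\<forall>j\<in>{1..<n}. set (take j (map \<pi> [0..<n])) \<noteq> {..<j})" if "n > 0"
  proof -
    have "{1..n - 1} = {1..<n}" using that by auto
    then show ?thesis
      unfolding splitting_time_1_gt_iff by (intro ball_cong) (auto simp: splits_at_iff_take)
  qed
  ultimately show ?thesis by blast
qed

text \<open>Besides being almost surely bijective, the factorization of prefix probabilities at a splitting time is
  the only property of the biased permutation that enters the regenerative property.\<close>

locale factorizing_permutation = prob_space M for M :: "'a measure" +
  fixes \<sigma> :: "'a \<Rightarrow> nat \<Rightarrow> nat"
  assumes measurable_permutation [measurable]: "\<sigma> \<in> measurable M seq_space"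
    and AE_bij: "AE \<omega> in M. bij (\<sigma> \<omega>)"
    and factor: "\<And>n xs ys. xs \<in> permutations_of_set {..<n} \<Longrightarrow> distinct ys \<Longrightarrow>
      emeasure M {\<omega> \<in> space M. \<sigma> \<omega> \<in> cylinder (xs @ map ((+) n) ys)} =
      emeasure M {\<omega> \<in> space M. \<sigma> \<omega> \<in> cylinder xs} * emeasure M {\<omega> \<in> space M. \<sigma> \<omega> \<in> cylinder ys}"
begin

lemma AE_inj: "AE \<omega> in M. inj (\<sigma> \<omega>)"
  using AE_bij by eventually_elim (rule bij_is_inj)

lemma cylinder_permutation_iff:
  assumes "xs \<in> permutations_of_set {..<n}"
  shows "\<pi> \<in> cylinder xs \<longleftrightarrow> map \<pi> [0..<n] = xs"
    and "\<pi> \<in> cylinder xs \<Longrightarrow> splits_at \<pi> n"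
proof -
  have "length xs = n" using length_finite_permutations_of_set[OF assms] by simp
  then show *: "\<pi> \<in> cylinder xs \<longleftrightarrow> map \<pi> [0..<n] = xs" by (simp add: cylinder_def)
  show "\<pi> \<in> cylinder xs \<Longrightarrow> splits_at \<pi> n"
    using assms unfolding * splits_at_iff_permutation by simp
qed

text \<open>For lists \<open>ys\<close> with repetitions both sides vanish.\<close>

lemma emeasure_cylinder_shift_cylinder:
  assumes xs: "xs \<in> permutations_of_set {..<n}"
  shows "emeasure M {\<omega> \<in> space M. \<sigma> \<omega> \<in> cylinder xs \<and> shift_seq n (\<sigma> \<omega>) \<in> cylinder ys} =
    emeasure M {\<omega> \<in> space M. \<sigma> \<omega> \<in> cylinder xs} * emeasure M {\<omega> \<in> space M. \<sigma> \<omega> \<in> cylinder ys}"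
proof (cases "distinct ys")
  case True
  have len: "length xs = n" using length_finite_permutations_of_set[OF xs] by simp
  have "emeasure M {\<omega> \<in> space M. \<sigma> \<omega> \<in> cylinder xs \<and> shift_seq n (\<sigma> \<omega>) \<in> cylinder ys} =
      emeasure M {\<omega> \<in> space M. \<sigma> \<omega> \<in> cylinder (xs @ map ((+) n) ys)}"
  proof (rule emeasure_eq_AE)
    show "AE \<omega> in M. \<omega> \<in> {\<omega> \<in> space M. \<sigma> \<omega> \<in> cylinder xs \<and> shift_seq n (\<sigma> \<omega>) \<in> cylinder ys} \<longleftrightarrow>
        \<omega> \<in> {\<omega> \<in> space M. \<sigma> \<omega> \<in> cylinder (xs @ map ((+) n) ys)}"
      using AE_inj
    proof eventually_elim
      case (elim \<omega>)
      have "\<sigma> \<omega> \<in> cylinder (xs @ map ((+) n) ys) \<longleftrightarrow>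
          \<sigma> \<omega> \<in> cylinder xs \<and> (\<forall>j<length ys. \<sigma> \<omega> (n + j) = n + ys ! j)"
      proof -
        have "(\<forall>i<n + m. P i) \<longleftrightarrow> (\<forall>i<n. P i) \<and> (\<forall>j<m. P (n + j))" for m P
          by (metis add_less_cancel_left le_Suc_ex not_le trans_less_add1)
        then show ?thesis by (auto simp: mem_cylinder_iff len nth_append)
      qed
      moreover have "shift_seq n (\<sigma> \<omega>) \<in> cylinder ys \<longleftrightarrow> (\<forall>j<length ys. \<sigma> \<omega> (n + j) = n + ys ! j)"
        if "\<sigma> \<omega> \<in> cylinder xs"
        using shift_seq_eq_iff[OF cylinder_permutation_iff(2)[OF xs that] elim]
        by (simp add: mem_cylinder_iff)
      ultimately show ?case by blast
    qed
  qed measurable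
  also note factor[OF xs True]
  finally show ?thesis .
next
  case False
  then obtain i j where ij: "i < length ys" "j < length ys" "i \<noteq> j" "ys ! i = ys ! j"
    by (auto simp: distinct_conv_nth)
  have "AE \<omega> in M. \<not> (\<sigma> \<omega> \<in> cylinder xs \<and> shift_seq n (\<sigma> \<omega>) \<in> cylinder ys)"
    using AE_inj
  proof eventually_elim
    case (elim \<omega>)
    show ?case
    proof
      assume *: "\<sigma> \<omega> \<in> cylinder xs \<and> shift_seq n (\<sigma> \<omega>) \<in> cylinder ys"
      then have "shift_seq n (\<sigma> \<omega>) i = shift_seq n (\<sigma> \<omega>) j"
        using ij by (simp add: mem_cylinder_iff)
      moreover have "inj (shift_seq n (\<sigma> \<omega>))"
        using * by (intro inj_shift_seq[OF cylinder_permutation_iff(2)[OF xs] elim]) simp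
      ultimately show False using ij(3) by (simp add: inj_eq)
    qed
  qed
  moreover have "AE \<omega> in M. \<not> \<sigma> \<omega> \<in> cylinder ys"
    using AE_inj
  proof eventually_elim
    case (elim \<omega>)
    show ?case using ij inj_eq[OF elim, of i j] by (metis mem_cylinder_iff)
  qed
  ultimately show ?thesis by (simp add: emeasure_eq_0_AE)
qed

lemma regeneration_cylinder:
  assumes xs: "xs \<in> permutations_of_set {..<n}" and B: "B \<in> sets seq_space"
  shows "emeasure M {\<omega> \<in> space M. \<sigma> \<omega> \<in> cylinder xs \<and> shift_seq n (\<sigma> \<omega>) \<in> B} =
    emeasure M {\<omega> \<in> space M. \<sigma> \<omega> \<in> cylinder xs} * emeasure M {\<omega> \<in> space M. \<sigma> \<omega> \<in> B}"
proof -
  let ?E = "{\<omega> \<in> space M. \<sigma> \<omega> \<in> cylinder xs}"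
  let ?N = "distr (density M (indicator ?E)) seq_space (\<lambda>\<omega>. shift_seq n (\<sigma> \<omega>))"
  let ?N' = "scale_measure (emeasure M ?E) (distr M seq_space \<sigma>)"
  have E [measurable]: "?E \<in> sets M" by measurable
  have N: "emeasure ?N A = emeasure M {\<omega> \<in> space M. \<sigma> \<omega> \<in> cylinder xs \<and> shift_seq n (\<sigma> \<omega>) \<in> A}"
    if [measurable]: "A \<in> sets seq_space" for A
  proof -
    have "emeasure ?N A = emeasure M (?E \<inter> ((\<lambda>\<omega>. shift_seq n (\<sigma> \<omega>)) -` A \<inter> space M))"
      by (simp add: emeasure_distr emeasure_restricted)
    also have "?E \<inter> ((\<lambda>\<omega>. shift_seq n (\<sigma> \<omega>)) -` A \<inter> space M) =
        {\<omega> \<in> space M. \<sigma> \<omega> \<in> cylinder xs \<and> shift_seq n (\<sigma> \<omega>) \<in> A}" by auto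
    finally show ?thesis .
  qed
  have N': "emeasure ?N' A = emeasure M ?E * emeasure M {\<omega> \<in> space M. \<sigma> \<omega> \<in> A}"
    if "A \<in> sets seq_space" for A
    using that by (simp add: emeasure_distr vimage_def Int_def conj_commute)
  have "?N = ?N'"
  proof (rule seq_space_measure_eqI)
    show "emeasure ?N UNIV \<noteq> \<infinity>"
      using sets.top[of seq_space] by (subst N) (auto simp: emeasure_eq_measure)
    show "emeasure ?N (cylinder l) = emeasure ?N' (cylinder l)" for l
      by (simp only: N N' cylinder_in_sets emeasure_cylinder_shift_cylinder[OF xs])
  qed simp_all
  then show ?thesis using N[OF B] N'[OF B] by simp
qed

text \<open>Given a split at \<open>n\<close>, the shifted permutation is independent of the first \<open>n\<close> values and has the law of \<open>\<sigma>\<close>.\<close>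

lemma regeneration:
  assumes B [measurable]: "B \<in> sets seq_space"
  shows "emeasure M {\<omega> \<in> space M. splits_at (\<sigma> \<omega>) n \<and> Q (map (\<sigma> \<omega>) [0..<n]) \<and> shift_seq n (\<sigma> \<omega>) \<in> B} =
    emeasure M {\<omega> \<in> space M. splits_at (\<sigma> \<omega>) n \<and> Q (map (\<sigma> \<omega>) [0..<n])} *
    emeasure M {\<omega> \<in> space M. \<sigma> \<omega> \<in> B}"
proof -
  let ?I = "{xs \<in> permutations_of_set {..<n}. Q xs}"
  have sum: "emeasure M {\<omega> \<in> space M. splits_at (\<sigma> \<omega>) n \<and> Q (map (\<sigma> \<omega>) [0..<n]) \<and> R \<omega>} =
      (\<Sum>xs\<in>?I. emeasure M {\<omega> \<in> space M. \<sigma> \<omega> \<in> cylinder xs \<and> R \<omega>})"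
    if [measurable]: "Measurable.pred M R" for R
  proof -
    let ?F = "\<lambda>xs. {\<omega> \<in> space M. \<sigma> \<omega> \<in> cylinder xs \<and> R \<omega>}"
    have "{\<omega> \<in> space M. splits_at (\<sigma> \<omega>) n \<and> Q (map (\<sigma> \<omega>) [0..<n]) \<and> R \<omega>} = (\<Union>xs\<in>?I. ?F xs)"
      by (auto simp: splits_at_iff_permutation cylinder_permutation_iff(1))
    moreover have "disjoint_family_on ?F ?I"
      by (auto simp: disjoint_family_on_def cylinder_permutation_iff(1))
    moreover have "?F ` ?I \<subseteq> sets M" by auto
    ultimately show ?thesis by (simp only:) (rule sum_emeasure[symmetric], simp_all)
  qed
  have "emeasure M {\<omega> \<in> space M. splits_at (\<sigma> \<omega>) n \<and> Q (map (\<sigma> \<omega>) [0..<n]) \<and> shift_seq n (\<sigma> \<omega>) \<in> B} =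
      (\<Sum>xs\<in>?I. emeasure M {\<omega> \<in> space M. \<sigma> \<omega> \<in> cylinder xs} * emeasure M {\<omega> \<in> space M. \<sigma> \<omega> \<in> B})"
    by (subst sum) (auto intro!: sum.cong regeneration_cylinder)
  also have "\<dots> = (\<Sum>xs\<in>?I. emeasure M {\<omega> \<in> space M. \<sigma> \<omega> \<in> cylinder xs \<and> True}) *
      emeasure M {\<omega> \<in> space M. \<sigma> \<omega> \<in> B}"
    by (simp add: sum_distrib_right)
  also have "(\<Sum>xs\<in>?I. emeasure M {\<omega> \<in> space M. \<sigma> \<omega> \<in> cylinder xs \<and> True}) =
      emeasure M {\<omega> \<in> space M. splits_at (\<sigma> \<omega>) n \<and> Q (map (\<sigma> \<omega>) [0..<n]) \<and> True}"
    by (rule sum[symmetric]) simp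
  finally show ?thesis by simp
qed

lemma distr_shift_seq:
  assumes pos: "emeasure M {\<omega> \<in> space M. splits_at (\<sigma> \<omega>) n} \<noteq> 0"
  shows "distr (uniform_measure M {\<omega> \<in> space M. splits_at (\<sigma> \<omega>) n}) seq_space (\<lambda>\<omega>. shift_seq n (\<sigma> \<omega>)) =
    distr M seq_space \<sigma>" (is "distr ?U _ _ = _")
proof (rule measure_eqI)
  fix B assume "B \<in> sets (distr ?U seq_space (\<lambda>\<omega>. shift_seq n (\<sigma> \<omega>)))"
  then have B [measurable]: "B \<in> sets seq_space" by simp
  let ?E = "{\<omega> \<in> space M. splits_at (\<sigma> \<omega>) n}"
  have "emeasure (distr ?U seq_space (\<lambda>\<omega>. shift_seq n (\<sigma> \<omega>))) B =
      emeasure M (?E \<inter> ((\<lambda>\<omega>. shift_seq n (\<sigma> \<omega>)) -` B \<inter> space M)) / emeasure M ?E"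
    by (simp add: emeasure_distr)
  also have "?E \<inter> ((\<lambda>\<omega>. shift_seq n (\<sigma> \<omega>)) -` B \<inter> space M) =
      {\<omega> \<in> space M. splits_at (\<sigma> \<omega>) n \<and> True \<and> shift_seq n (\<sigma> \<omega>) \<in> B}" by auto
  also have "emeasure M \<dots> = emeasure M ?E * emeasure M {\<omega> \<in> space M. \<sigma> \<omega> \<in> B}"
    using regeneration[OF B, of n "\<lambda>_. True"] by simp
  also have "\<dots> / emeasure M ?E = emeasure M {\<omega> \<in> space M. \<sigma> \<omega> \<in> B}"
    using pos emeasure_finite[of ?E] by (subst mult.commute, intro ennreal_mult_divide_eq) simp_all
  also have "\<dots> = emeasure (distr M seq_space \<sigma>) B"
    by (simp add: emeasure_distr vimage_def Int_def conj_commute)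
  finally show "emeasure (distr ?U seq_space (\<lambda>\<omega>. shift_seq n (\<sigma> \<omega>))) B = emeasure (distr M seq_space \<sigma>) B" .
qed simp

section \<open>The law of the splitting times\<close>

text \<open>The law of the first splitting time, which may be infinite.\<close>

definition gap_pmf :: "enat pmf" where
  "gap_pmf = Abs_pmf (distr M (count_space UNIV) (\<lambda>\<omega>. splitting_time (\<sigma> \<omega>) 1))"

lemma measure_gap_pmf:
  "measure_pmf gap_pmf = distr M (count_space UNIV) (\<lambda>\<omega>. splitting_time (\<sigma> \<omega>) 1)"
proof -
  let ?N = "distr M (count_space UNIV) (\<lambda>\<omega>. splitting_time (\<sigma> \<omega>) 1)"
  interpret N: prob_space ?N by (rule prob_space_distr) measurable
  have "AE x in ?N. measure ?N {x} \<noteq> 0"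
    by (subst N.AE_support_countable) (auto intro!: exI[of _ UNIV])
  then show ?thesis
    unfolding gap_pmf_def by (intro Abs_pmf_inverse) (simp add: N.prob_space_axioms del: One_nat_def)
qed

lemma emeasure_gap_pmf:
  "emeasure gap_pmf A = emeasure M {\<omega> \<in> space M. splitting_time (\<sigma> \<omega>) 1 \<in> A}"
  by (simp add: measure_gap_pmf emeasure_distr vimage_def Int_def conj_commute)

lemma splitting_time_1_neq_0: "splitting_time \<pi> 1 \<noteq> 0"
  using splitting_time_less_Suc[of \<pi> 0] by auto

lemma zero_notin_gap_pmf: "0 \<notin> set_pmf gap_pmf"
proof -
  have "emeasure gap_pmf {0} = 0" unfolding emeasure_gap_pmf
    using splitting_time_1_neq_0 by simp
  then show ?thesis by (simp add: set_pmf_iff emeasure_pmf_single)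
qed

text \<open>Regeneration at the first splitting time, which is determined by the values before it. For \<open>t = \<infinity>\<close> all
  later times are infinite as well.\<close>

lemma splitting_time_cons:
  "emeasure M {\<omega> \<in> space M. splitting_time (\<sigma> \<omega>) 1 = t \<and>
      (\<forall>k<m. splitting_time (\<sigma> \<omega>) (Suc (Suc k)) = f k)} =
    emeasure M {\<omega> \<in> space M. splitting_time (\<sigma> \<omega>) 1 = t} *
    emeasure M {\<omega> \<in> space M. \<forall>k<m. t + splitting_time (\<sigma> \<omega>) (Suc k) = f k}"
proof (cases t)
  case (enat n)
  let ?Q = "\<lambda>xs. n > 0 \<and> (\<forall>j\<in>{1..<n}. set (take j xs) \<noteq> {..<j})"
  let ?B = "{\<pi> \<in> space seq_space. \<forall>k<m. t + splitting_time \<pi> (Suc k) = f k}"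
  have [measurable]: "(\<lambda>\<pi>. t + splitting_time \<pi> (Suc k)) \<in> measurable seq_space (count_space UNIV)" for k
    by (rule measurable_compose[OF measurable_splitting_time_nth]) simp
  have B [measurable]: "?B \<in> sets seq_space" by measurable
  have Q: "splitting_time \<pi> 1 = t \<longleftrightarrow> splits_at \<pi> n \<and> ?Q (map \<pi> [0..<n])" for \<pi>
    unfolding enat splitting_time_1_eq_iff by blast
  have "emeasure M {\<omega> \<in> space M. splitting_time (\<sigma> \<omega>) 1 = t \<and>
      (\<forall>k<m. splitting_time (\<sigma> \<omega>) (Suc (Suc k)) = f k)} =
    emeasure M {\<omega> \<in> space M. splitting_time (\<sigma> \<omega>) 1 = t \<and> shift_seq n (\<sigma> \<omega>) \<in> ?B}"
  proof (rule emeasure_eq_AE)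
    show "AE \<omega> in M. \<omega> \<in> {\<omega> \<in> space M. splitting_time (\<sigma> \<omega>) 1 = t \<and>
      (\<forall>k<m. splitting_time (\<sigma> \<omega>) (Suc (Suc k)) = f k)} \<longleftrightarrow>
      \<omega> \<in> {\<omega> \<in> space M. splitting_time (\<sigma> \<omega>) 1 = t \<and> shift_seq n (\<sigma> \<omega>) \<in> ?B}"
      using AE_inj
    proof eventually_elim
      case (elim \<omega>)
      have "splitting_time (\<sigma> \<omega>) (Suc (Suc k)) = t + splitting_time (shift_seq n (\<sigma> \<omega>)) (Suc k)"
        if "splitting_time (\<sigma> \<omega>) 1 = t" for k
        using splitting_time_shift_seq[OF elim, of n "Suc k"] that enat by simp
      then show ?case by auto
    qed
  qed measurable
  also have "\<dots> = emeasure M {\<omega> \<in> space M. splits_at (\<sigma> \<omega>) n \<and> ?Q (map (\<sigma> \<omega>) [0..<n]) \<and>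
      shift_seq n (\<sigma> \<omega>) \<in> ?B}"
    unfolding Q by (simp only: conj_assoc)
  also have "\<dots> = emeasure M {\<omega> \<in> space M. splitting_time (\<sigma> \<omega>) 1 = t} *
      emeasure M {\<omega> \<in> space M. \<sigma> \<omega> \<in> ?B}"
    unfolding Q by (rule regeneration[OF B])
  finally show ?thesis by simp
next
  case infinity
  have "splitting_time \<pi> (Suc (Suc k)) = \<infinity>" if "splitting_time \<pi> 1 = \<infinity>" for \<pi> k
    using splitting_time_mono[of 1 "Suc (Suc k)" \<pi>] that by simp
  then have *: "{\<omega> \<in> space M. splitting_time (\<sigma> \<omega>) 1 = t \<and>
      (\<forall>k<m. splitting_time (\<sigma> \<omega>) (Suc (Suc k)) = f k)} =
      {\<omega> \<in> space M. splitting_time (\<sigma> \<omega>) 1 = t \<and> (\<forall>k<m. \<infinity> = f k)}"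
    unfolding infinity by (auto simp del: One_nat_def)
  obtain b where b: "(\<forall>k<m. \<infinity> = f k) = b" by blast
  show ?thesis
    unfolding * unfolding infinity plus_enat_simps b by (cases b) (simp_all add: emeasure_space_1)
qed

text \<open>The renewal times after time \<open>0\<close>, for given gaps \<open>y\<close>.\<close>

definition gap_sums :: "(nat \<Rightarrow> enat) \<Rightarrow> nat \<Rightarrow> enat" where
  "gap_sums y n = (\<Sum>i<Suc n. y i)"

lemma measurable_gap_sums_nth [measurable]:
  "(\<lambda>y. \<Sum>i<n. y i :: enat) \<in> measurable seq_space (count_space UNIV)"
proof (induction n)
  case (Suc n)
  have "(\<lambda>y. (\<Sum>i<n. y i) + y n :: enat) \<in> measurable seq_space (count_space UNIV)"
    by (rule measurable_compose_countable[where f = "\<lambda>(a :: enat) y. (\<Sum>i<n. y i) + a" and g = "\<lambda>y. y n"],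
        rule measurable_compose[OF Suc]) simp_all
  then show ?case by simp
qed simp

text \<open>By induction on the length, comparing regeneration at the first splitting time with the separation of
  the first gap from the others.\<close>

lemma emeasure_splitting_times_eq:
  "emeasure M {\<omega> \<in> space M. (\<lambda>k. splitting_time (\<sigma> \<omega>) (Suc k)) \<in> cylinder l} =
    emeasure (PiM UNIV (\<lambda>_. measure_pmf gap_pmf)) {y. gap_sums y \<in> cylinder l}"
proof (induction "length l" arbitrary: l)
  case 0
  interpret S: sequence_space "measure_pmf gap_pmf" ..
  have "emeasure S.S (space S.S) = 1" by (rule S.P.emeasure_space_1)
  with 0 show ?case by (simp add: mem_cylinder_iff emeasure_space_1 space_PiM)
next
  case (Suc m tl)
  then obtain t l where tl: "tl = t # l" and m: "m = length l" by (cases tl) auto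
  interpret S: sequence_space "measure_pmf gap_pmf" ..
  have sp: "space S.S = UNIV" by (simp add: space_PiM)
  have sets [measurable_cong]: "sets S.S = sets seq_space" by (intro sets_PiM_cong) simp_all
  have all_Suc: "(\<forall>j<length (t # l). P j) \<longleftrightarrow> P 0 \<and> (\<forall>k<length l. P (Suc k))" for P
    by (auto simp: less_Suc_eq_0_disj)
  let ?A = "{y. gap_sums y \<in> cylinder (t # l)}"
  let ?B = "{y. \<forall>k<length l. t + gap_sums y k = l ! k}"
  have meas [measurable]: "(\<lambda>y. t + gap_sums y k) \<in> measurable seq_space (count_space UNIV)"
    "(\<lambda>y. gap_sums y k) \<in> measurable seq_space (count_space UNIV)" for t k
    unfolding gap_sums_def by (rule measurable_compose[OF measurable_gap_sums_nth]; simp)+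
  have "{y \<in> space seq_space. \<forall>k<length (t # l). gap_sums y k = (t # l) ! k} \<in> sets seq_space" by measurable
  then have A: "?A \<in> sets S.S" by (simp add: mem_cylinder_iff sets)
  have "{y \<in> space seq_space. \<forall>k<length l. t + gap_sums y k = l ! k} \<in> sets seq_space" by measurable
  then have B: "?B \<in> sets S.S" by (simp add: sets)
  have "emeasure S.S ?A = emeasure (distr (measure_pmf gap_pmf \<Otimes>\<^sub>M S.S) S.S (\<lambda>(s, y). case_nat s y)) ?A"
    by (simp only: S.PiM_iter)
  also have "\<dots> = emeasure (measure_pmf gap_pmf \<Otimes>\<^sub>M S.S)
      ((\<lambda>(s, y). case_nat s y) -` ?A \<inter> space (measure_pmf gap_pmf \<Otimes>\<^sub>M S.S))"
    by (rule emeasure_distr[OF _ A]) measurable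
  also have "(\<lambda>(s, y). case_nat s y) -` ?A \<inter> space (measure_pmf gap_pmf \<Otimes>\<^sub>M S.S) = {t} \<times> ?B"
  proof -
    have "gap_sums (case_nat s y) 0 = s" "gap_sums (case_nat s y) (Suc k) = s + gap_sums y k" for s y k
      unfolding gap_sums_def by (simp, subst sum.lessThan_Suc_shift, simp)
    then show ?thesis
      unfolding mem_cylinder_iff all_Suc by (auto simp: space_pair_measure sp)
  qed
  also have "emeasure (measure_pmf gap_pmf \<Otimes>\<^sub>M S.S) ({t} \<times> ?B) = emeasure gap_pmf {t} * emeasure S.S ?B"
    using B by (intro S.P.emeasure_pair_measure_Times) simp_all
  also have "emeasure gap_pmf {t} = emeasure M {\<omega> \<in> space M. splitting_time (\<sigma> \<omega>) 1 = t}"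
    by (simp add: emeasure_gap_pmf)
  also have "emeasure S.S ?B =
      emeasure M {\<omega> \<in> space M. \<forall>k<length l. t + splitting_time (\<sigma> \<omega>) (Suc k) = l ! k}"
  proof (cases t)
    case (enat n)
    \<comment> \<open>Either \<open>t\<close> can be subtracted throughout \<open>l\<close>, or both events are empty.\<close>
    show ?thesis
    proof (cases "\<exists>l'. l = map ((+) t) l'")
      case True
      then obtain l' where l': "l = map ((+) t) l'" ..
      have "(\<forall>k<length l. t + x k = l ! k) \<longleftrightarrow> (\<forall>k<length l'. x k = l' ! k)" for x
        by (simp add: l' enat)
      then show ?thesis
        using Suc.hyps(1)[of l'] by (simp add: mem_cylinder_iff l' m)
    next
      case False
      have no: "(\<forall>k<length l. t + x k = l ! k) \<longleftrightarrow> False" for x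
      proof (rule iffI)
        assume "\<forall>k<length l. t + x k = l ! k"
        then have "l = map ((+) t) (map x [0..<length l])" by (intro nth_equalityI) auto
        with False show False by blast
      qed simp
      show ?thesis unfolding no by simp
    qed
  next
    case infinity
    have "emeasure S.S (space S.S) = 1" by (rule S.P.emeasure_space_1)
    moreover obtain b where b: "(\<forall>k<length l. \<infinity> = l ! k) = b" by blast
    ultimately show ?thesis
      unfolding infinity plus_enat_simps b by (cases b) (simp_all add: sp emeasure_space_1)
  qed
  also have "emeasure M {\<omega> \<in> space M. splitting_time (\<sigma> \<omega>) 1 = t} * \<dots> =
    emeasure M {\<omega> \<in> space M. splitting_time (\<sigma> \<omega>) 1 = t \<and>
      (\<forall>k<length l. splitting_time (\<sigma> \<omega>) (Suc (Suc k)) = l ! k)}"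
    by (rule splitting_time_cons[symmetric])
  finally show ?case
    unfolding tl mem_cylinder_iff all_Suc by simp
qed

lemma splitting_time_seq_in_cylinder_iff:
  "splitting_time \<pi> \<in> cylinder (t # l) \<longleftrightarrow> t = 0 \<and> (\<lambda>k. splitting_time \<pi> (Suc k)) \<in> cylinder l"
  by (auto simp: mem_cylinder_iff less_Suc_eq_0_disj)

lemma renewal_process_splitting_time:
  "renewal_process (return_pmf 0) gap_pmf M (\<lambda>\<omega>. splitting_time (\<sigma> \<omega>))"
proof -
  let ?S = "PiM UNIV (\<lambda>_. measure_pmf gap_pmf)"
  interpret S: sequence_space "measure_pmf gap_pmf" ..
  have sp: "space S.S = UNIV" by (simp add: space_PiM)
  have sets [measurable_cong]: "sets S.S = sets seq_space" by (intro sets_PiM_cong) simp_all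
  let ?d = "measure_pmf (return_pmf (0 :: nat))"
  let ?f = "\<lambda>z n. enat (fst z) + (\<Sum>i<n. snd z i)"
  have f1: "?f \<in> measurable (?d \<Otimes>\<^sub>M S.S) seq_space"
  proof (rule measurable_PiM_single')
    fix n
    have 1: "(\<lambda>z. \<Sum>i<n. snd z i) \<in> measurable (?d \<Otimes>\<^sub>M S.S) (count_space UNIV)"
      by (rule measurable_compose[OF measurable_snd]) measurable
    have 2: "fst \<in> measurable (?d \<Otimes>\<^sub>M S.S) (count_space UNIV)" by measurable
    show "(\<lambda>z. ?f z n) \<in> measurable (?d \<Otimes>\<^sub>M S.S) (count_space UNIV)"
      by (rule measurable_compose_countable[where f = "\<lambda>a z. enat a + (\<Sum>i<n. snd z i)" and g = fst])
        (simp_all add: measurable_compose[OF 1] 2)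
  qed (simp add: space_PiM)
  have "distr M seq_space (\<lambda>\<omega>. splitting_time (\<sigma> \<omega>)) = distr (?d \<Otimes>\<^sub>M S.S) seq_space ?f"
  proof (rule seq_space_measure_eqI)
    have "emeasure (distr M seq_space (\<lambda>\<omega>. splitting_time (\<sigma> \<omega>))) UNIV = emeasure M (space M)"
      using sets.top[of "seq_space :: (nat \<Rightarrow> enat) measure"] by (subst emeasure_distr) simp_all
    then show "emeasure (distr M seq_space (\<lambda>\<omega>. splitting_time (\<sigma> \<omega>))) UNIV \<noteq> \<infinity>"
      by (simp add: emeasure_space_1)
    fix l :: "enat list"
    have R: "emeasure (distr (?d \<Otimes>\<^sub>M S.S) seq_space ?f) (cylinder l) =
        emeasure S.S {y. (\<lambda>n. \<Sum>i<n. y i) \<in> cylinder l}"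
    proof -
      have m: "?f -` cylinder l \<inter> space (?d \<Otimes>\<^sub>M S.S) \<in> sets (?d \<Otimes>\<^sub>M S.S)"
        using f1 by (rule measurable_sets) simp
      have "emeasure (distr (?d \<Otimes>\<^sub>M S.S) seq_space ?f) (cylinder l) =
          (\<integral>\<^sup>+t. emeasure S.S (Pair t -` (?f -` cylinder l \<inter> space (?d \<Otimes>\<^sub>M S.S))) \<partial>?d)"
        by (simp add: emeasure_distr[OF f1] S.P.emeasure_pair_measure_alt[OF m])
      also have "\<dots> = emeasure S.S (Pair 0 -` (?f -` cylinder l \<inter> space (?d \<Otimes>\<^sub>M S.S)))"
        by (simp add: nn_integral_return_pmf)
      also have "Pair 0 -` (?f -` cylinder l \<inter> space (?d \<Otimes>\<^sub>M S.S)) = {y. (\<lambda>n. \<Sum>i<n. y i) \<in> cylinder l}"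
        by (auto simp: space_pair_measure sp zero_enat_def[symmetric])
      finally show ?thesis .
    qed
    have L: "emeasure (distr M seq_space (\<lambda>\<omega>. splitting_time (\<sigma> \<omega>))) (cylinder l) =
        emeasure M {\<omega> \<in> space M. splitting_time (\<sigma> \<omega>) \<in> cylinder l}"
      by (simp add: emeasure_distr vimage_def Int_def conj_commute)
    show "emeasure (distr M seq_space (\<lambda>\<omega>. splitting_time (\<sigma> \<omega>))) (cylinder l) =
      emeasure (distr (?d \<Otimes>\<^sub>M S.S) seq_space ?f) (cylinder l)"
    proof (cases l)
      case Nil
      have "emeasure S.S (space S.S) = 1" by (rule S.P.emeasure_space_1)
      then show ?thesis unfolding L R by (simp add: Nil mem_cylinder_iff emeasure_space_1 sp)
    next
      case (Cons t l')
      have "(\<lambda>n. \<Sum>i<n. y i) \<in> cylinder (t # l') \<longleftrightarrow> t = 0 \<and> gap_sums y \<in> cylinder l'" for y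
        by (auto simp: mem_cylinder_iff less_Suc_eq_0_disj gap_sums_def)
      then show ?thesis
        unfolding L R unfolding Cons splitting_time_seq_in_cylinder_iff
        using emeasure_splitting_times_eq[of l'] by (cases "t = 0") simp_all
    qed
  qed simp_all
  then show ?thesis
    unfolding renewal_process_def case_prod_unfold
    using zero_notin_gap_pmf by simp
qed

end

section \<open>Regenerative permutations\<close>

lemma measurable_renewal_indicator [measurable]:
  "(\<lambda>t. renewal_indicator t n) \<in> measurable seq_space (count_space UNIV)"
  unfolding renewal_indicator_def by measurable

lemma measurable_future_0 [measurable]:
  "(\<lambda>(\<pi>, t). future 0 \<pi> t) \<in> measurable (seq_space \<Otimes>\<^sub>M seq_space) (seq_space \<Otimes>\<^sub>M seq_space)"
proof -
  have "(\<lambda>z. (fst z, \<lambda>k. renewal_indicator (snd z) (Suc k)))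
      \<in> measurable ((seq_space :: (nat \<Rightarrow> nat) measure) \<Otimes>\<^sub>M seq_space) (seq_space \<Otimes>\<^sub>M seq_space)"
  proof (rule measurable_Pair)
    show "(\<lambda>z. \<lambda>k. renewal_indicator (snd z) (Suc k)) \<in>
        measurable ((seq_space :: (nat \<Rightarrow> nat) measure) \<Otimes>\<^sub>M seq_space) seq_space"
      by (rule measurable_PiM_single') (auto simp: space_PiM intro: measurable_compose[OF measurable_snd])
  qed measurable
  then show ?thesis by (simp add: future_def case_prod_unfold)
qed

text \<open>A permutation with the indicators of its splits at the times \<open>1\<close>, \<open>2\<close>, \dots As the indicators are
  determined by the permutation, the law of this pair is determined by the law of the permutation.\<close>

definition split_pattern :: "(nat \<Rightarrow> nat) \<Rightarrow> (nat \<Rightarrow> nat) \<times> (nat \<Rightarrow> nat)" where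
  "split_pattern \<pi> = (\<pi>, \<lambda>k. of_bool (splits_at \<pi> (Suc k)))"

lemma measurable_split_pattern [measurable]:
  "split_pattern \<in> measurable seq_space (seq_space \<Otimes>\<^sub>M seq_space)"
  unfolding split_pattern_def
proof (rule measurable_Pair)
  show "(\<lambda>\<pi> k. of_bool (splits_at \<pi> (Suc k)) :: nat) \<in> measurable seq_space seq_space"
  proof (rule measurable_PiM_single')
    fix k
    have "(\<lambda>\<pi>. if splits_at \<pi> (Suc k) then 1 else 0 :: nat) \<in> measurable seq_space (count_space UNIV)"
      by measurable
    then show "(\<lambda>\<pi>. of_bool (splits_at \<pi> (Suc k)) :: nat) \<in> measurable seq_space (count_space UNIV)"
      by (simp add: of_bool_def)
  qed (simp add: space_PiM)
qed simp

lemma future_splitting_time: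
  assumes "splits_at \<pi> n" "inj \<pi>"
  shows "future n \<pi> (splitting_time \<pi>) = split_pattern (shift_seq n \<pi>)"
  using splits_at_shift_seq[OF assms]
  by (simp add: future_def split_pattern_def renewal_indicator_splitting_time shift_seq_def fun_eq_iff)

lemma future_0_splitting_time: "future 0 \<pi> (splitting_time \<pi>) = split_pattern \<pi>"
  by (simp add: future_def split_pattern_def renewal_indicator_splitting_time)

context factorizing_permutation
begin

lemma measurable_future:
  "(\<lambda>\<omega>. future n (\<sigma> \<omega>) (splitting_time (\<sigma> \<omega>))) \<in> measurable M (seq_space \<Otimes>\<^sub>M seq_space)"
proof -
  have "(\<lambda>\<pi>. (shift_seq n \<pi>, \<lambda>k. renewal_indicator (splitting_time \<pi>) (n + k + 1)))
      \<in> measurable seq_space (seq_space \<Otimes>\<^sub>M seq_space)"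
  proof (rule measurable_Pair)
    show "(\<lambda>\<pi> k. renewal_indicator (splitting_time \<pi>) (n + k + 1)) \<in> measurable seq_space seq_space"
      by (rule measurable_PiM_single')
        (auto simp: space_PiM intro: measurable_compose[OF measurable_splitting_time])
  qed simp
  from measurable_compose[OF measurable_permutation this]
  show ?thesis by (simp add: future_def shift_seq_def[abs_def])
qed

theorem regenerative_splitting_time: "regenerative M \<sigma> (\<lambda>\<omega>. splitting_time (\<sigma> \<omega>))"
proof -
  let ?T = "\<lambda>\<omega>. splitting_time (\<sigma> \<omega>)"
  let ?S2 = "(seq_space :: (nat \<Rightarrow> nat) measure) \<Otimes>\<^sub>M (seq_space :: (nat \<Rightarrow> enat) measure)"
  \<comment> \<open>The law of \<open>\<sigma>\<^sup>0\<close> and its renewal process is that of \<open>\<sigma>\<close> and its own splitting times.\<close>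
  define Q where "Q = distr M ?S2 (\<lambda>\<omega>. (\<sigma> \<omega>, ?T \<omega>))"
  have pair [measurable]: "(\<lambda>\<omega>. (\<sigma> \<omega>, ?T \<omega>)) \<in> measurable M ?S2" by measurable
  have sets_Q [measurable_cong]: "sets Q = sets ?S2" by (simp add: Q_def)
  have "Measurable.pred seq_space (\<lambda>\<pi> :: nat \<Rightarrow> nat. (\<forall>i j. \<pi> i = \<pi> j \<longrightarrow> i = j) \<and> (\<forall>y. \<exists>x. \<pi> x = y))"
    by measurable
  moreover have "(\<forall>i j. \<pi> i = \<pi> j \<longrightarrow> i = j) \<and> (\<forall>y. \<exists>x. \<pi> x = y) \<longleftrightarrow> bij \<pi>" for \<pi> :: "nat \<Rightarrow> nat"
    unfolding bij_def inj_def surj_def by metis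
  ultimately have bij_pred [measurable]: "Measurable.pred seq_space (\<lambda>\<pi> :: nat \<Rightarrow> nat. bij \<pi>)"
    by simp
  have rp: "random_permutation M \<sigma>"
    by (simp add: random_permutation_def AE_bij)
  have rpQ: "random_permutation Q fst"
    unfolding random_permutation_def
  proof
    show "fst \<in> measurable Q seq_space" by measurable
    show "AE z in Q. bij (fst z)"
      unfolding Q_def by (subst AE_distr_iff[OF pair]) (simp_all add: AE_bij)
  qed
  have "distr Q seq_space snd = distr M seq_space ?T"
    unfolding Q_def by (subst distr_distr) (simp_all add: comp_def)
  moreover have "snd \<in> measurable Q seq_space" by measurable
  ultimately have "renewal_process (return_pmf 0) gap_pmf Q snd"
    using renewal_process_splitting_time unfolding renewal_process_def by (simp only:) blast
  then have zQ: "zero_delay_renewal Q snd" unfolding zero_delay_renewal_def ..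
  have future_Q: "distr Q (seq_space \<Otimes>\<^sub>M seq_space) (\<lambda>(\<pi>, t). future 0 \<pi> t) =
      distr M (seq_space \<Otimes>\<^sub>M seq_space) (\<lambda>\<omega>. split_pattern (\<sigma> \<omega>))"
    unfolding Q_def by (subst distr_distr) (simp_all add: comp_def future_0_splitting_time)
  have reg: "distr (given_renewal M ?T n) (seq_space \<Otimes>\<^sub>M seq_space) (\<lambda>\<omega>. future n (\<sigma> \<omega>) (?T \<omega>)) =
        distr Q (seq_space \<Otimes>\<^sub>M seq_space) (\<lambda>(\<pi>, t). future 0 \<pi> t) \<and>
      independent_vars (given_renewal M ?T n)
        (PiM {..n} (\<lambda>_. count_space UNIV)) (\<lambda>\<omega>. \<lambda>i\<in>{..n}. renewal_indicator (?T \<omega>) i)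
        (seq_space \<Otimes>\<^sub>M seq_space) (\<lambda>\<omega>. future n (\<sigma> \<omega>) (?T \<omega>))"
    if pos: "measure M {\<omega> \<in> space M. renewal_indicator (?T \<omega>) n = 1} > 0" for n
  proof -
    let ?E = "{\<omega> \<in> space M. splits_at (\<sigma> \<omega>) n}"
    let ?U = "uniform_measure M ?E"
    let ?P2 = "(seq_space :: (nat \<Rightarrow> nat) measure) \<Otimes>\<^sub>M (seq_space :: (nat \<Rightarrow> nat) measure)"
    let ?fut = "\<lambda>\<omega>. future n (\<sigma> \<omega>) (?T \<omega>)"
    let ?ind = "\<lambda>\<omega>. \<lambda>i\<in>{..n}. renewal_indicator (?T \<omega>) i"
    let ?PI = "PiM {..n} (\<lambda>_. count_space UNIV) :: (nat \<Rightarrow> nat) measure"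
    have E_eq: "{\<omega> \<in> space M. renewal_indicator (?T \<omega>) n = 1} = ?E"
      by (auto simp: renewal_indicator_splitting_time)
    have U: "given_renewal M ?T n = ?U" unfolding given_renewal_def E_eq ..
    have E [measurable]: "?E \<in> sets M" by measurable
    have E0: "emeasure M ?E \<noteq> 0" using pos unfolding E_eq by (simp add: emeasure_eq_measure)
    interpret U: prob_space ?U by (rule prob_space_uniform_measure) (use E0 in auto)
    have fut [measurable]: "?fut \<in> measurable M ?P2" by (rule measurable_future)
    have ind [measurable]: "?ind \<in> measurable M ?PI"
      by (rule measurable_restrict) measurable
    have AE_fut: "AE \<omega> in M. \<omega> \<in> ?E \<longrightarrow> ?fut \<omega> = split_pattern (shift_seq n (\<sigma> \<omega>))"
      using AE_inj by eventually_elim (simp add: future_splitting_time)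
    then have AE_U: "AE \<omega> in ?U. ?fut \<omega> = split_pattern (shift_seq n (\<sigma> \<omega>))"
      by (intro AE_uniform_measureI E) auto
    have "distr ?U ?P2 ?fut = distr ?U ?P2 (\<lambda>\<omega>. split_pattern (shift_seq n (\<sigma> \<omega>)))"
      by (rule distr_cong_AE[OF refl refl AE_U]) measurable
    also have "\<dots> = distr (distr ?U seq_space (\<lambda>\<omega>. shift_seq n (\<sigma> \<omega>))) ?P2 split_pattern"
      by (subst distr_distr) (simp_all add: comp_def)
    also have "\<dots> = distr M ?P2 (\<lambda>\<omega>. split_pattern (\<sigma> \<omega>))"
      unfolding distr_shift_seq[OF E0] by (subst distr_distr) (simp_all add: comp_def)
    finally have 1: "distr ?U ?P2 ?fut = distr M ?P2 (\<lambda>\<omega>. split_pattern (\<sigma> \<omega>))" .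
    have indep: "independent_vars ?U ?PI ?ind ?P2 ?fut"
      unfolding independent_vars_def
    proof (intro conjI U.indep_setI)
      show "?ind \<in> measurable ?U ?PI" "?fut \<in> measurable ?U ?P2" by measurable
      have sp: "space ?U = space M" by simp
      have ind': "?ind \<in> space ?U \<rightarrow> space ?PI" using measurable_space[OF ind] by auto
      have fut': "?fut \<in> space ?U \<rightarrow> space ?P2" using measurable_space[OF fut] by auto
      show "sets (vimage_algebra (space ?U) ?ind ?PI) \<subseteq> U.events"
        "sets (vimage_algebra (space ?U) ?fut ?P2) \<subseteq> U.events"
        unfolding sets_vimage_algebra2[OF ind'] sets_vimage_algebra2[OF fut']
        using measurable_sets[OF ind] measurable_sets[OF fut] by auto
      fix a b
      assume "a \<in> sets (vimage_algebra (space ?U) ?ind ?PI)" "b \<in> sets (vimage_algebra (space ?U) ?fut ?P2)"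
      then obtain A B where A: "A \<in> sets ?PI" "a = ?ind -` A \<inter> space M"
        and B: "B \<in> sets ?P2" "b = ?fut -` B \<inter> space M"
        unfolding sets_vimage_algebra2[OF ind'] sets_vimage_algebra2[OF fut'] by auto
      have ab [measurable]: "a \<in> sets M" "b \<in> sets M"
        using measurable_sets[OF ind A(1)] measurable_sets[OF fut B(1)] A(2) B(2) by auto
      define B' where "B' = split_pattern -` B"
      have B' [measurable]: "B' \<in> sets seq_space"
        using measurable_sets[OF measurable_split_pattern B(1)] by (simp add: B'_def)
      \<comment> \<open>The indicators up to time \<open>n\<close> are a function of the first \<open>n\<close> values of \<open>\<sigma>\<close>.\<close>
      define R where "R xs \<longleftrightarrow> (\<lambda>i\<in>{..n}. of_bool (set (take i xs) = {..<i})) \<in> A" for xs :: "nat list"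
      have aR: "\<omega> \<in> a \<longleftrightarrow> \<omega> \<in> space M \<and> R (map (\<sigma> \<omega>) [0..<n])" for \<omega>
      proof -
        have "?ind \<omega> = (\<lambda>i\<in>{..n}. of_bool (set (take i (map (\<sigma> \<omega>) [0..<n])) = {..<i}))"
          by (auto simp: renewal_indicator_splitting_time splits_at_iff_take simp del: take_map)
        then show ?thesis by (auto simp: A R_def)
      qed
      have bB: "AE \<omega> in M. \<omega> \<in> ?E \<longrightarrow> (\<omega> \<in> b \<longleftrightarrow> shift_seq n (\<sigma> \<omega>) \<in> B')"
        using AE_fut by eventually_elim (auto simp: B B'_def)
      have eq1: "emeasure M (?E \<inter> (a \<inter> b)) = emeasure M (?E \<inter> a) * emeasure M {\<omega> \<in> space M. \<sigma> \<omega> \<in> B'}"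
      proof -
        have "{\<omega> \<in> space M. splits_at (\<sigma> \<omega>) n \<and> R (map (\<sigma> \<omega>) [0..<n])} = ?E \<inter> a"
          by (auto simp: aR)
        moreover have "{\<omega> \<in> space M. splits_at (\<sigma> \<omega>) n \<and> R (map (\<sigma> \<omega>) [0..<n]) \<and> shift_seq n (\<sigma> \<omega>) \<in> B'} =
            ?E \<inter> a \<inter> {\<omega> \<in> space M. shift_seq n (\<sigma> \<omega>) \<in> B'}"
          by (auto simp: aR)
        moreover have "emeasure M (?E \<inter> (a \<inter> b)) = emeasure M (?E \<inter> a \<inter> {\<omega> \<in> space M. shift_seq n (\<sigma> \<omega>) \<in> B'})"
        proof (rule emeasure_eq_AE)
          show "AE \<omega> in M. \<omega> \<in> ?E \<inter> (a \<inter> b) \<longleftrightarrow>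
              \<omega> \<in> ?E \<inter> a \<inter> {\<omega> \<in> space M. shift_seq n (\<sigma> \<omega>) \<in> B'}"
            using bB AE_space by eventually_elim auto
        qed measurable
        ultimately show ?thesis using regeneration[OF B', of n R] by simp
      qed
      have eq2: "emeasure M (?E \<inter> b) = emeasure M ?E * emeasure M {\<omega> \<in> space M. \<sigma> \<omega> \<in> B'}"
      proof -
        have "{\<omega> \<in> space M. splits_at (\<sigma> \<omega>) n \<and> True \<and> shift_seq n (\<sigma> \<omega>) \<in> B'} =
            ?E \<inter> {\<omega> \<in> space M. shift_seq n (\<sigma> \<omega>) \<in> B'}"
          by auto
        moreover have "emeasure M (?E \<inter> b) = emeasure M (?E \<inter> {\<omega> \<in> space M. shift_seq n (\<sigma> \<omega>) \<in> B'})"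
        proof (rule emeasure_eq_AE)
          show "AE \<omega> in M. \<omega> \<in> ?E \<inter> b \<longleftrightarrow> \<omega> \<in> ?E \<inter> {\<omega> \<in> space M. shift_seq n (\<sigma> \<omega>) \<in> B'}"
            using bB AE_space by eventually_elim auto
        qed measurable
        ultimately show ?thesis using regeneration[OF B', of n "\<lambda>_. True"] by simp
      qed
      have m1: "prob (?E \<inter> (a \<inter> b)) = prob (?E \<inter> a) * prob {\<omega> \<in> space M. \<sigma> \<omega> \<in> B'}"
        using eq1 by (simp add: emeasure_eq_measure flip: ennreal_mult)
      have m2: "prob (?E \<inter> b) = prob ?E * prob {\<omega> \<in> space M. \<sigma> \<omega> \<in> B'}"
        using eq2 by (simp add: emeasure_eq_measure flip: ennreal_mult)
      have "prob ?E \<noteq> 0" using E0 by (simp add: emeasure_eq_measure)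
      then show "U.prob (a \<inter> b) = U.prob a * U.prob b"
        using E0 by (simp add: m1 m2 emeasure_eq_measure)
    qed
    show ?thesis unfolding U future_Q using 1 indep by blast
  qed
  have "prob_space Q" unfolding Q_def by (rule prob_space_distr[OF pair])
  then show ?thesis
    unfolding regenerative_def
    using rp sets_Q rpQ zQ reg renewal_process_splitting_time splits_at_splitting_time
    by (auto simp: delayed_renewal_def intro!: exI[of _ Q])
qed

end

section \<open>The mean of the first splitting time\<close>

context factorizing_permutation
begin

text \<open>The \<open>k\<close>-th term is the probability that \<open>k\<close> is the last split up to time \<open>n\<close>.\<close>

lemma sum_renewal_le_1:
  "(\<Sum>k\<le>n. emeasure M {\<omega> \<in> space M. splits_at (\<sigma> \<omega>) k} *
      emeasure M {\<omega> \<in> space M. enat (n - k) < splitting_time (\<sigma> \<omega>) 1}) \<le> 1"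
proof -
  let ?A = "\<lambda>k. {\<omega> \<in> space M. splits_at (\<sigma> \<omega>) k \<and> (\<forall>j\<in>{k<..n}. \<not> splits_at (\<sigma> \<omega>) j)}"
  have A: "?A k \<in> sets M" for k by measurable
  have "emeasure M (?A k) = emeasure M {\<omega> \<in> space M. splits_at (\<sigma> \<omega>) k} *
      emeasure M {\<omega> \<in> space M. enat (n - k) < splitting_time (\<sigma> \<omega>) 1}" if "k \<le> n" for k
  proof -
    let ?B = "{\<pi> \<in> space seq_space. enat (n - k) < splitting_time \<pi> 1}"
    have B [measurable]: "?B \<in> sets seq_space" by measurable
    have "emeasure M (?A k) =
        emeasure M {\<omega> \<in> space M. splits_at (\<sigma> \<omega>) k \<and> True \<and> shift_seq k (\<sigma> \<omega>) \<in> ?B}"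
    proof (rule emeasure_eq_AE)
      show "AE \<omega> in M. \<omega> \<in> ?A k \<longleftrightarrow>
          \<omega> \<in> {\<omega> \<in> space M. splits_at (\<sigma> \<omega>) k \<and> True \<and> shift_seq k (\<sigma> \<omega>) \<in> ?B}"
        using AE_inj
      proof eventually_elim
        case (elim \<omega>)
        have "(\<forall>j\<in>{k<..n}. \<not> splits_at (\<sigma> \<omega>) j) \<longleftrightarrow> shift_seq k (\<sigma> \<omega>) \<in> ?B"
          if "splits_at (\<sigma> \<omega>) k"
        proof -
          have "{k<..n} = (+) k ` {1..n - k}"
            using \<open>k \<le> n\<close> by (simp add: atLeastSucAtMost_greaterThanAtMost[symmetric])
          then have "(\<forall>j\<in>{k<..n}. \<not> splits_at (\<sigma> \<omega>) j) \<longleftrightarrow>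
              (\<forall>j\<in>{1..n - k}. \<not> splits_at (\<sigma> \<omega>) (k + j))" by (simp only: image_iff bex_simps ball_simps) blast
          also have "\<dots> \<longleftrightarrow> (\<forall>j\<in>{1..n - k}. \<not> splits_at (shift_seq k (\<sigma> \<omega>)) j)"
            by (simp only: splits_at_shift_seq[OF that elim])
          also have "\<dots> \<longleftrightarrow> shift_seq k (\<sigma> \<omega>) \<in> ?B"
            unfolding space_seq_space mem_Collect_eq splitting_time_1_gt_iff by simp
          finally show ?thesis .
        qed
        then show ?case by blast
      qed
    qed measurable
    also have "\<dots> = emeasure M {\<omega> \<in> space M. splits_at (\<sigma> \<omega>) k \<and> True} *
        emeasure M {\<omega> \<in> space M. \<sigma> \<omega> \<in> ?B}"
      by (rule regeneration[OF B])
    finally show ?thesis by simp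
  qed
  then have "(\<Sum>k\<le>n. emeasure M {\<omega> \<in> space M. splits_at (\<sigma> \<omega>) k} *
      emeasure M {\<omega> \<in> space M. enat (n - k) < splitting_time (\<sigma> \<omega>) 1}) =
      (\<Sum>k\<le>n. emeasure M (?A k))"
    by (intro sum.cong) auto
  also have "\<dots> = emeasure M (\<Union>k\<le>n. ?A k)"
  proof (rule sum_emeasure)
    show "disjoint_family_on ?A {..n}"
      unfolding disjoint_family_on_def
    proof (intro ballI impI)
      fix i j assume "i \<in> {..n}" "j \<in> {..n}" "i \<noteq> j"
      then show "?A i \<inter> ?A j = {}" by (cases "i < j") auto
    qed
  qed (use A in auto)
  also have "\<dots> \<le> 1" by (rule measure_le_1)
  finally show ?thesis .
qed

theorem finite_mean_splitting_time:
  assumes c: "c > 0" "\<And>n. n \<ge> n0 \<Longrightarrow> ennreal c \<le> emeasure M {\<omega> \<in> space M. splits_at (\<sigma> \<omega>) n}"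
  shows "(\<integral>\<^sup>+\<omega>. ennreal_of_enat (splitting_time (\<sigma> \<omega>) 1) \<partial>M) < \<infinity>"
proof -
  let ?t = "\<lambda>j. emeasure M {\<omega> \<in> space M. enat j < splitting_time (\<sigma> \<omega>) 1}"
  have "(\<integral>\<^sup>+\<omega>. ennreal_of_enat (splitting_time (\<sigma> \<omega>) 1) \<partial>M) = (\<Sum>j. ?t j)"
    by (rule nn_integral_enat_function) measurable
  also have "\<dots> = (SUP m. \<Sum>j<m. ?t j)" by (rule suminf_eq_SUP)
  also have "\<dots> \<le> ennreal (1 / c)"
  proof (rule SUP_least)
    fix m
    have "ennreal c * (\<Sum>j<m. ?t j) \<le> ennreal c * (\<Sum>j\<le>m. ?t j)"
      by (intro mult_left_mono sum_mono2) auto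
    also have "\<dots> = (\<Sum>k\<in>{n0..n0 + m}. ennreal c * ?t (n0 + m - k))"
      unfolding sum_distrib_left
      by (rule sum.reindex_bij_witness[of _ "\<lambda>k. n0 + m - k" "\<lambda>j. n0 + m - j"]) auto
    also have "\<dots> \<le> (\<Sum>k\<in>{n0..n0 + m}. emeasure M {\<omega> \<in> space M. splits_at (\<sigma> \<omega>) k} * ?t (n0 + m - k))"
      using c(2) by (intro sum_mono mult_right_mono) auto
    also have "\<dots> \<le> (\<Sum>k\<le>n0 + m. emeasure M {\<omega> \<in> space M. splits_at (\<sigma> \<omega>) k} * ?t (n0 + m - k))"
      by (intro sum_mono2) auto
    also have "\<dots> \<le> 1" by (rule sum_renewal_le_1)
    finally have "ennreal (1 / c) * (ennreal c * (\<Sum>j<m. ?t j)) \<le> ennreal (1 / c) * 1"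
      by (intro mult_left_mono) auto
    then show "(\<Sum>j<m. ?t j) \<le> ennreal (1 / c)"
      using c(1) by (simp add: mult.assoc[symmetric] ennreal_mult'[symmetric])
  qed
  also have "\<dots> < \<infinity>" by simp
  finally show ?thesis .
qed

lemma emeasure_splits_at:
  "emeasure M {\<omega> \<in> space M. splits_at (\<sigma> \<omega>) n} =
    (\<Sum>xs\<in>permutations_of_set {..<n}. emeasure M {\<omega> \<in> space M. \<sigma> \<omega> \<in> cylinder xs})"
proof -
  let ?F = "\<lambda>xs. {\<omega> \<in> space M. \<sigma> \<omega> \<in> cylinder xs}"
  have "{\<omega> \<in> space M. splits_at (\<sigma> \<omega>) n} = (\<Union>xs\<in>permutations_of_set {..<n}. ?F xs)"
    by (auto simp: splits_at_iff_permutation cylinder_permutation_iff(1))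
  moreover have "disjoint_family_on ?F (permutations_of_set {..<n})"
    by (auto simp: disjoint_family_on_def cylinder_permutation_iff(1))
  moreover have "?F ` permutations_of_set {..<n} \<subseteq> sets M" by auto
  ultimately show ?thesis by (simp only:) (rule sum_emeasure[symmetric], simp_all)
qed

end

section \<open>A lower bound for the probability of a split\<close>

text \<open>The list of samples has length \<open>k = \<lceil>a / s\<rceil>\<close>, where \<open>s\<close> is the length left after \<open>n\<close> pieces. Then
  \<open>(1 - s)\<^sup>k\<close>, the probability that all samples are below \<open>n\<close>, is bounded below, and given this
  event \<open>i\<close> is missing with probability at most \<open>exp (- (a * b (n - i)))\<close>.\<close>

lemma sum_succ_prob_stick_ge:
  assumes w: "\<And>i. 0 < w i \<and> w i < 1"
    and S: "(\<Prod>j<n. 1 - w j) \<le> 1 / 2"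
    and b: "\<And>m. 0 \<le> b m" "\<And>i. i < n \<Longrightarrow> b (n - i) * (\<Prod>j=i..<n. 1 - w j) \<le> w i"
    and a: "0 \<le> a" "(\<Sum>i<n. exp (- (a * b (n - i)))) \<le> 1 / 2"
  shows "exp (- 2 * (a + 1)) / 2 \<le> (\<Sum>xs\<in>permutations_of_set {..<n}. succ_prob (stick w) xs)"
proof -
  define s where "s = (\<Prod>j<n. 1 - w j)"
  define k where "k = nat \<lceil>a / s\<rceil>"
  let ?p = "stick w"
  have s: "0 < s" "s \<le> 1 / 2" using S w by (simp_all add: s_def prod_pos)
  have k: "a / s \<le> real k" "real k \<le> a / s + 1"
    using a(1) s unfolding k_def by (linarith | simp)+
  have p_pos: "0 < ?p i" for i using w by (rule stick_pos)
  have p_sum: "finite A \<Longrightarrow> sum ?p A < 1" for A using w by (rule sum_stick_less_1)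
  have sum: "sum ?p {..<n} = 1 - s" by (simp add: sum_stick s_def)
  have p: "s * b (n - i) \<le> ?p i" if "i < n" for i
  proof -
    have "s = (\<Prod>j<i. 1 - w j) * (\<Prod>j=i..<n. 1 - w j)"
      unfolding s_def using that
      by (simp add: prod.atLeastLessThan_concat[of 0 i n] flip: atLeast0LessThan)
    then have "s * b (n - i) = (\<Prod>j<i. 1 - w j) * (b (n - i) * (\<Prod>j=i..<n. 1 - w j))" by simp
    also have "\<dots> \<le> (\<Prod>j<i. 1 - w j) * w i"
      using w b(2)[OF that] by (intro mult_left_mono) (auto intro!: prod_nonneg intro: less_imp_le)
    finally show ?thesis by (simp add: stick_def)
  qed
  have le: "(1 - s - ?p i) ^ k \<le> (1 - s) ^ k * exp (- (a * b (n - i)))" if "i < n" for i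
  proof -
    have "?p i \<le> sum ?p {..<n}"
      using that p_pos by (intro member_le_sum) (auto intro: less_imp_le)
    then have "0 \<le> 1 - s - ?p i" by (simp add: sum)
    moreover have "1 - s - ?p i \<le> (1 - s) * (1 - ?p i)"
      using s p_pos[of i] by (simp add: algebra_simps)
    moreover have "(1 - s) * (1 - ?p i) \<le> (1 - s) * exp (- ?p i)"
      using s exp_ge_add_one_self[of "- ?p i"] by (intro mult_left_mono) auto
    ultimately have "(1 - s - ?p i) ^ k \<le> ((1 - s) * exp (- ?p i)) ^ k"
      by (intro power_mono) auto
    also have "\<dots> = (1 - s) ^ k * exp (- (real k * ?p i))"
      by (simp add: power_mult_distrib exp_of_nat_mult[symmetric])
    also have "\<dots> \<le> (1 - s) ^ k * exp (- (a * b (n - i)))"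
    proof -
      have "a * b (n - i) = (a / s) * (s * b (n - i))" using s by simp
      also have "\<dots> \<le> real k * ?p i"
        using k(1) p[OF that] a(1) s b(1)[of "n - i"] p_pos[of i]
        by (intro mult_mono) (auto intro: less_imp_le)
      finally show ?thesis using s by (intro mult_left_mono) auto
    qed
    finally show ?thesis .
  qed
  have "exp (- 2 * (a + 1)) / 2 \<le> (1 - s) ^ k / 2"
  proof -
    have "- (2 * s) \<le> - s - 2 * s\<^sup>2" using s by (simp add: power2_eq_square)
    also have "\<dots> \<le> ln (1 - s)" using s by (intro ln_one_minus_pos_lower_bound) auto
    finally have "real k * - (2 * s) \<le> real k * ln (1 - s)" by (intro mult_left_mono) auto
    moreover have "- 2 * (a + 1) \<le> real k * - (2 * s)"
    proof -
      have "real k * s \<le> (a / s + 1) * s" using k(2) s by (intro mult_right_mono) auto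
      also have "\<dots> \<le> a + 1" using s by (simp add: field_simps)
      finally show ?thesis by simp
    qed
    ultimately have "exp (- 2 * (a + 1)) \<le> exp (real k * ln (1 - s))" by simp
    also have "\<dots> = (1 - s) ^ k" using s by (simp add: exp_of_nat_mult)
    finally show ?thesis by simp
  qed
  also have "\<dots> \<le> (1 - s) ^ k * (1 - (\<Sum>i<n. exp (- (a * b (n - i)))))"
  proof -
    have "(1 - s) ^ k * (1 / 2) \<le> (1 - s) ^ k * (1 - (\<Sum>i<n. exp (- (a * b (n - i)))))"
      using a(2) s by (intro mult_left_mono) auto
    then show ?thesis by simp
  qed
  also have "\<dots> = (1 - s) ^ k - (\<Sum>i<n. (1 - s) ^ k * exp (- (a * b (n - i))))"
    by (simp add: right_diff_distrib sum_distrib_left)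
  also have "\<dots> \<le> (1 - s) ^ k - (\<Sum>i<n. (1 - s - ?p i) ^ k)"
    using le by (intro diff_mono sum_mono) auto
  also have "\<dots> \<le> (\<Sum>xs\<in>permutations_of_set {..<n}. succ_prob ?p xs)"
    using sum_succ_prob_permutations_ge[OF p_pos p_sum, of "{..<n}" k] by (simp add: sum)
  finally show ?thesis .
qed

text \<open>For \<open>a \<ge> 1\<close>, every term \<open>exp (- (a * b m))\<close> is at most \<open>exp (- ((a - 1) * \<beta>))\<close> times \<open>exp (- b m)\<close>.\<close>

lemma exp_minus_scaled_sum_bounded:
  fixes b :: "nat \<Rightarrow> real"
  assumes \<beta>: "0 < \<beta>" "\<And>m. \<beta> \<le> b m" and sm: "summable (\<lambda>m. exp (- b m))"
  obtains a where "0 \<le> a" "\<And>A. finite A \<Longrightarrow> (\<Sum>m\<in>A. exp (- (a * b m))) \<le> 1 / 2"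
proof
  define C where "C = (\<Sum>m. exp (- b m))"
  define a where "a = 1 + ln (2 * C + 1) / \<beta>"
  have C: "0 \<le> C" unfolding C_def by (intro suminf_nonneg sm) simp
  show "0 \<le> a" using C \<beta>(1) by (simp add: a_def)
  fix A :: "nat set" assume A: "finite A"
  have le: "exp (- (a * b m)) \<le> exp (- b m) * (1 / (2 * C + 1))" for m
  proof -
    have "ln (2 * C + 1) = (a - 1) * \<beta>" using \<beta>(1) by (simp add: a_def)
    also have "\<dots> \<le> (a - 1) * b m" using C \<beta> by (intro mult_left_mono) (simp_all add: a_def)
    finally have "exp (- (a * b m)) \<le> exp (- b m + - ln (2 * C + 1))" by (simp add: algebra_simps)
    also have "\<dots> = exp (- b m) * (1 / (2 * C + 1))"
      using C unfolding exp_add by (simp add: exp_minus field_simps)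
    finally show ?thesis .
  qed
  have "(\<Sum>m\<in>A. exp (- (a * b m))) \<le> (\<Sum>m\<in>A. exp (- b m)) * (1 / (2 * C + 1))"
    unfolding sum_distrib_right by (intro sum_mono le)
  also have "\<dots> \<le> C * (1 / (2 * C + 1))"
    using C unfolding C_def by (intro mult_right_mono sum_le_suminf sm A) auto
  also have "\<dots> \<le> 1 / 2" using C by (simp add: field_simps)
  finally show "(\<Sum>m\<in>A. exp (- (a * b m))) \<le> 1 / 2" .
qed

text \<open>\<open>W\<close> stands for the common law of the factors \<open>Ws i\<close>.\<close>

locale iid_factors = prob_space M for M :: "'a measure" +
  fixes W :: "'a \<Rightarrow> real" and Ws :: "nat \<Rightarrow> 'a \<Rightarrow> real"
  assumes measurable_W [measurable]: "W \<in> borel_measurable M"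
    and indep: "indep_vars (\<lambda>_. borel) Ws UNIV"
    and distr_Ws: "\<And>i. distr M borel (Ws i) = distr M borel W"
    and W_range: "\<And>\<omega>. \<omega> \<in> space M \<Longrightarrow> 0 < W \<omega> \<and> W \<omega> < 1"
    and Ws_range: "\<And>i \<omega>. \<omega> \<in> space M \<Longrightarrow> 0 < Ws i \<omega> \<and> Ws i \<omega> < 1"
    and log_W: "(\<integral>\<^sup>+ \<omega>. ennreal (- ln (W \<omega>)) \<partial>M) < \<infinity>"
begin

lemma measurable_Ws [measurable]: "Ws i \<in> borel_measurable M"
  using indep by (auto simp: indep_vars_def)

lemma prob_Ws_less: "prob {\<omega> \<in> space M. Ws i \<omega> < x} = prob {\<omega> \<in> space M. W \<omega> < x}"
proof -
  have "measure (distr M borel (Ws i)) {..<x} = measure (distr M borel W) {..<x}"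
    by (simp add: distr_Ws)
  then show ?thesis by (simp add: measure_distr vimage_def Int_def conj_commute)
qed

text \<open>Markov's inequality for the product, whose mean is the power \<open>\<E>(1 - W) ^ card J\<close>. Taking \<open>r\<close>
  strictly between \<open>\<E>(1 - W)\<close> and \<open>1\<close> makes it positive.\<close>

lemma ex_prod_bound:
  obtains r where "0 < r" "r < 1"
    "\<And>J x. finite J \<Longrightarrow> 0 < x \<Longrightarrow> prob {\<omega> \<in> space M. x \<le> (\<Prod>j\<in>J. 1 - Ws j \<omega>)} \<le> r ^ card J / x"
proof -
  define r0 where "r0 = expectation (\<lambda>\<omega>. 1 - W \<omega>)"
  have intW: "integrable M W"
  proof (rule integrable_const_bound[of _ 1])
    have "norm (W \<omega>) \<le> 1" if "\<omega> \<in> space M" for \<omega> using W_range[OF that] by simp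
    then show "AE \<omega> in M. norm (W \<omega>) \<le> 1" by (rule AE_I2)
  qed simp
  have "expectation W \<noteq> 0"
  proof
    assume "expectation W = 0"
    then have "AE \<omega> in M. W \<omega> = 0"
      using W_range intW by (subst (asm) integral_nonneg_eq_0_iff_AE) (auto intro!: AE_I2 intro: less_imp_le)
    then have "AE \<omega> in M. False" using AE_space by eventually_elim (use W_range in force)
    then show False by simp
  qed
  moreover have "expectation W \<ge> 0" "r0 \<ge> 0"
    unfolding r0_def using W_range by (auto intro!: integral_nonneg_AE AE_I2 intro: less_imp_le)
  moreover have "r0 = 1 - expectation W" unfolding r0_def using intW by (simp add: prob_space)
  ultimately have r0: "0 \<le> r0" "r0 < 1" by simp_all
  have int: "(\<integral>\<^sup>+\<omega>. ennreal (1 - Ws j \<omega>) \<partial>M) = ennreal r0" for j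
  proof -
    have "(\<integral>\<^sup>+\<omega>. ennreal (1 - Ws j \<omega>) \<partial>M) = (\<integral>\<^sup>+w. ennreal (1 - w) \<partial>distr M borel (Ws j))"
      by (subst nn_integral_distr) simp_all
    also have "\<dots> = (\<integral>\<^sup>+\<omega>. ennreal (1 - W \<omega>) \<partial>M)"
      unfolding distr_Ws by (subst nn_integral_distr) simp_all
    also have "\<dots> = ennreal r0"
      unfolding r0_def using intW W_range
      by (intro nn_integral_eq_integral) (auto intro!: AE_I2 intro: less_imp_le)
    finally show ?thesis .
  qed
  have prod: "(\<integral>\<^sup>+\<omega>. ennreal (\<Prod>j\<in>J. 1 - Ws j \<omega>) \<partial>M) = ennreal (r0 ^ card J)" if "finite J" for J
  proof -
    have "(\<integral>\<^sup>+\<omega>. ennreal (\<Prod>j\<in>J. 1 - Ws j \<omega>) \<partial>M) = (\<integral>\<^sup>+\<omega>. (\<Prod>j\<in>J. ennreal (1 - Ws j \<omega>)) \<partial>M)"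
      using Ws_range by (intro nn_integral_cong prod_ennreal[symmetric]) (simp add: less_imp_le)
    also have "\<dots> = (\<Prod>j\<in>J. \<integral>\<^sup>+\<omega>. ennreal (1 - Ws j \<omega>) \<partial>M)"
    proof (rule indep_vars_nn_integral[OF that])
      show "indep_vars (\<lambda>_. borel) (\<lambda>j \<omega>. ennreal (1 - Ws j \<omega>)) J"
        by (rule indep_vars_compose2[OF indep_vars_subset[OF indep]]) auto
    qed simp
    also have "\<dots> = ennreal (r0 ^ card J)" by (simp add: int ennreal_power r0)
    finally show ?thesis .
  qed
  show thesis
  proof
    let ?r = "(r0 + 1) / 2"
    show "0 < ?r" "?r < 1" using r0 by simp_all
    fix J :: "nat set" and x :: real assume J: "finite J" and x: "0 < x"
    let ?A = "{\<omega> \<in> space M. x \<le> (\<Prod>j\<in>J. 1 - Ws j \<omega>)}"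
    have "emeasure M ?A \<le>
        emeasure M {\<omega> \<in> space M. 1 \<le> ennreal (1 / x) * ennreal (\<Prod>j\<in>J. 1 - Ws j \<omega>)}"
    proof (rule emeasure_mono)
      show "?A \<subseteq> {\<omega> \<in> space M. 1 \<le> ennreal (1 / x) * ennreal (\<Prod>j\<in>J. 1 - Ws j \<omega>)}"
      proof safe
        fix \<omega> assume "x \<le> (\<Prod>j\<in>J. 1 - Ws j \<omega>)"
        then have "1 \<le> 1 / x * (\<Prod>j\<in>J. 1 - Ws j \<omega>)" using x by (simp add: field_simps)
        then have "ennreal 1 \<le> ennreal (1 / x * (\<Prod>j\<in>J. 1 - Ws j \<omega>))" by (rule ennreal_leI)
        moreover have "ennreal (1 / x) * ennreal (\<Prod>j\<in>J. 1 - Ws j \<omega>) =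
            ennreal (1 / x * (\<Prod>j\<in>J. 1 - Ws j \<omega>))"
          using x by (intro ennreal_mult'[symmetric]) simp
        ultimately show "1 \<le> ennreal (1 / x) * ennreal (\<Prod>j\<in>J. 1 - Ws j \<omega>)" by simp
      qed
    qed measurable
    also have "\<dots> \<le> ennreal (1 / x) *
        (\<integral>\<^sup>+\<omega>. ennreal (\<Prod>j\<in>J. 1 - Ws j \<omega>) * indicator (space M) \<omega> \<partial>M)"
      by (rule nn_integral_Markov_inequality) measurable
    also have "(\<integral>\<^sup>+\<omega>. ennreal (\<Prod>j\<in>J. 1 - Ws j \<omega>) * indicator (space M) \<omega> \<partial>M) = ennreal (r0 ^ card J)"
      using prod[OF J] by (subst nn_integral_cong[where v = "\<lambda>\<omega>. ennreal (\<Prod>j\<in>J. 1 - Ws j \<omega>)"]) auto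
    also have "ennreal (1 / x) * ennreal (r0 ^ card J) = ennreal (r0 ^ card J / x)"
      using x r0 by (simp add: ennreal_mult'[symmetric])
    finally have "prob ?A \<le> r0 ^ card J / x"
      using x r0 by (simp add: emeasure_eq_measure)
    also have "\<dots> \<le> ?r ^ card J / x"
      using x r0 by (intro divide_right_mono power_mono) auto
    finally show "prob ?A \<le> ?r ^ card J / x" .
  qed
qed

text \<open>With \<open>d = - ln q\<close>, the sum is the expected number of \<open>m\<close> with \<open>m < - ln W / d\<close>.\<close>

lemma summable_prob_W_less_power:
  assumes q: "0 < q" "q < 1"
  shows "summable (\<lambda>m. prob {\<omega> \<in> space M. W \<omega> < q ^ m})"
proof (rule summableI_nonneg_bounded)
  let ?L = "\<lambda>\<omega>. - ln (W \<omega>)"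
  have L0: "0 \<le> ?L \<omega>" if "\<omega> \<in> space M" for \<omega> using W_range[OF that] by simp
  have intL: "integrable M ?L"
    by (rule integrableI_nonneg) (use log_W L0 in \<open>auto intro!: AE_I2\<close>)
  define d where "d = - ln q"
  have d: "0 < d" using q by (simp add: d_def)
  fix N
  have "(\<Sum>m<N. prob {\<omega> \<in> space M. W \<omega> < q ^ m}) =
      expectation (\<lambda>\<omega>. \<Sum>m<N. indicator {\<omega> \<in> space M. W \<omega> < q ^ m} \<omega>)"
    by (subst Bochner_Integration.integral_sum) (auto simp: emeasure_eq_measure)
  also have "\<dots> \<le> expectation (\<lambda>\<omega>. ?L \<omega> / d + 1)"
  proof (rule integral_mono)
    fix \<omega> assume \<omega>: "\<omega> \<in> space M"
    have "W \<omega> < q ^ m \<longleftrightarrow> real m < ?L \<omega> / d" for m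
    proof -
      have "W \<omega> < q ^ m \<longleftrightarrow> ln (W \<omega>) < real m * ln q"
        using W_range[OF \<omega>] q by (simp add: ln_realpow[symmetric])
      also have "\<dots> \<longleftrightarrow> real m < ?L \<omega> / d" using d by (simp add: d_def field_simps)
      finally show ?thesis .
    qed
    then have "(\<Sum>m<N. indicator {\<omega> \<in> space M. W \<omega> < q ^ m} \<omega>) = (\<Sum>m<N. of_bool (real m < ?L \<omega> / d))"
      using \<omega> by (intro sum.cong) (auto simp: indicator_def)
    also have "\<dots> = real (card {m \<in> {..<N}. real m < ?L \<omega> / d})"
      by (simp add: Int_def)
    also have "\<dots> \<le> real (card {..nat \<lfloor>?L \<omega> / d\<rfloor>})"
    proof (intro of_nat_mono card_mono)
      show "{m \<in> {..<N}. real m < ?L \<omega> / d} \<subseteq> {..nat \<lfloor>?L \<omega> / d\<rfloor>}"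
        by (auto simp: le_nat_floor less_imp_le)
    qed simp
    also have "\<dots> \<le> ?L \<omega> / d + 1"
      using of_nat_floor[of "?L \<omega> / d"] divide_nonneg_pos[OF L0[OF \<omega>] d] by simp
    finally show "(\<Sum>m<N. indicator {\<omega> \<in> space M. W \<omega> < q ^ m} \<omega>) \<le> ?L \<omega> / d + 1" .
  qed (use intL in \<open>auto intro!: Bochner_Integration.integrable_sum simp: emeasure_eq_measure\<close>)
  finally show "(\<Sum>m<N. prob {\<omega> \<in> space M. W \<omega> < q ^ m}) \<le> expectation (\<lambda>\<omega>. ?L \<omega> / d + 1)" .
qed simp

lemma ex_prob_split_ge:
  obtains c n0 where "0 < c"
    "\<And>n. n \<ge> n0 \<Longrightarrow> ennreal c \<le>
      (\<integral>\<^sup>+\<omega>. ennreal (\<Sum>xs\<in>permutations_of_set {..<n}. succ_prob (stick (\<lambda>i. Ws i \<omega>)) xs) \<partial>M)"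
proof -
  obtain r where r: "0 < r" "r < 1"
    and Markov: "\<And>J x. finite J \<Longrightarrow> 0 < x \<Longrightarrow>
      prob {\<omega> \<in> space M. x \<le> (\<Prod>j\<in>J. 1 - Ws j \<omega>)} \<le> r ^ card J / x"
    by (rule ex_prod_bound) blast
  \<comment> \<open>With \<open>m = n - i\<close>, typically \<open>Ws i \<ge> q\<^sup>m\<close>, while the product of \<open>1 - Ws j\<close> for \<open>i \<le> j < n\<close>, of mean at most
    \<open>r\<^sup>m = q\<^sup>4\<^sup>m\<close>, is below \<open>q\<^sup>2\<^sup>m\<close>. The ratio is then at least \<open>q\<^sup>-\<^sup>m\<close>. The exceptional probability is
    at most \<open>g m\<close>.\<close>
  define q where "q = sqrt (sqrt r)"
  have q: "0 < q" "q < 1" using r by (simp_all add: q_def)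
  have r_eq: "r = (q ^ 2) ^ 2" using r by (simp add: q_def)
  define f where "f m = prob {\<omega> \<in> space M. W \<omega> < q ^ m}" for m
  define g where "g m = f m + (q ^ 2) ^ m" for m
  have g0: "0 \<le> f m" "0 \<le> g m" for m using q by (simp_all add: f_def g_def)
  have sf: "summable f" unfolding f_def using q by (rule summable_prob_W_less_power)
  have "q ^ 2 < 1" using q by (simp add: power_less_one_iff)
  then have "summable (\<lambda>m. (q ^ 2) ^ m)" using q by (intro summable_geometric) simp
  then have sg: "summable g" unfolding g_def by (rule summable_add[OF sf])
  obtain m0 where m0: "norm (\<Sum>i. g (i + m0)) < 1 / 4"
    using suminf_exist_split[OF _ sg, of "1 / 4"] by auto
  have tail: "(\<Sum>m\<in>{m0..N}. g m) \<le> 1 / 4" for N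
  proof -
    have "(\<Sum>m\<in>{m0..N}. g m) \<le> (\<Sum>m\<in>(\<lambda>i. i + m0) ` {..N}. g m)"
    proof (rule sum_mono2)
      show "{m0..N} \<subseteq> (\<lambda>i. i + m0) ` {..N}"
      proof
        fix m assume "m \<in> {m0..N}"
        then show "m \<in> (\<lambda>i. i + m0) ` {..N}" by (intro image_eqI[of _ _ "m - m0"]) auto
      qed
    qed (simp_all add: g0)
    also have "\<dots> = (\<Sum>i\<le>N. g (i + m0))" by (simp add: sum.reindex)
    also have "\<dots> \<le> (\<Sum>i. g (i + m0))"
      using sg g0 by (intro sum_le_suminf) (simp_all add: summable_iff_shift)
    finally show ?thesis using m0 by simp
  qed
  \<comment> \<open>The sum of \<open>g\<close> over \<open>m < m0\<close> may exceed \<open>1\<close>. For these \<open>m\<close> a constant lower bound \<open>q\<^sup>m\<^sup>1\<close> for the ratio suffices,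
    and it fails with small probability.\<close>
  have "f \<longlonglongrightarrow> 0" by (rule summable_LIMSEQ_zero[OF sf])
  then have "eventually (\<lambda>m. f m < 1 / (4 * (real m0 + 1))) sequentially"
    by (rule order_tendstoD) simp
  then obtain m1 where m1: "f m1 < 1 / (4 * (real m0 + 1))" by (auto simp: eventually_sequentially)
  define b where "b m = (if m < m0 then q ^ m1 else 1 / q ^ m)" for m
  have qm: "q ^ m \<le> 1" "0 < q ^ m" for m using q by (simp_all add: power_le_one)
  have b_ge: "q ^ m1 \<le> b m" for m
    using qm[of m] qm[of m1] by (auto simp: b_def le_divide_eq_1 intro: order_trans)
  have sb: "summable (\<lambda>m. exp (- b m))"
  proof (rule summable_comparison_test')
    show "summable (\<lambda>m. q ^ m)" using q by (intro summable_geometric) simp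
    fix m assume "m0 \<le> m"
    then have "b m = 1 / q ^ m" by (simp add: b_def)
    moreover have "b m \<le> exp (b m)" using exp_ge_add_one_self[of "b m"] by linarith
    ultimately show "norm (exp (- b m)) \<le> q ^ m"
      using qm[of m] by (simp add: exp_minus field_simps)
  qed
  obtain a where a: "0 \<le> a" "\<And>A. finite A \<Longrightarrow> (\<Sum>m\<in>A. exp (- (a * b m))) \<le> 1 / 2"
    by (rule exp_minus_scaled_sum_bounded[OF qm(2)[of m1] b_ge sb]) blast
  have "(\<lambda>n. r ^ n) \<longlonglongrightarrow> 0" using r by (intro LIMSEQ_power_zero) simp
  then have "eventually (\<lambda>n. r ^ n < 1 / 8) sequentially" by (rule order_tendstoD) simp
  then obtain n0 where n0: "\<And>n. n \<ge> n0 \<Longrightarrow> r ^ n < 1 / 8" by (auto simp: eventually_sequentially)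
  define C where "C = exp (- 2 * (a + 1)) / 2"
  show thesis
  proof
    show "0 < C / 4" by (simp add: C_def)
    fix n assume n: "n0 \<le> n"
    define G where "G i \<omega> = (\<Prod>j=i..<n. 1 - Ws j \<omega>)" for i \<omega>
    have [measurable]: "G i \<in> borel_measurable M" for i unfolding G_def by measurable
    let ?bad = "\<lambda>i. {\<omega> \<in> space M. Ws i \<omega> < b (n - i) * G i \<omega>}"
    let ?S = "{\<omega> \<in> space M. 1 / 2 \<le> (\<Prod>j<n. 1 - Ws j \<omega>)}"
    let ?B = "(\<Union>i<n. ?bad i) \<union> ?S"
    have bad: "prob (?bad i) \<le> (if n - i < m0 then f m1 else g (n - i))" if "i < n" for i
    proof (cases "n - i < m0")
      case True
      have "?bad i \<subseteq> {\<omega> \<in> space M. Ws i \<omega> < q ^ m1}"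
      proof safe
        fix \<omega> assume \<omega>: "\<omega> \<in> space M" "Ws i \<omega> < b (n - i) * G i \<omega>"
        have "G i \<omega> \<le> 1" unfolding G_def
          using Ws_range[OF \<omega>(1)] by (intro prod_le_1) (auto intro: less_imp_le)
        then have "b (n - i) * G i \<omega> \<le> q ^ m1"
          using True qm(2)[of m1] by (simp add: b_def mult_left_le)
        with \<omega>(2) show "Ws i \<omega> < q ^ m1" by simp
      qed
      then have "prob (?bad i) \<le> prob {\<omega> \<in> space M. Ws i \<omega> < q ^ m1}"
        by (intro finite_measure_mono) measurable
      then show ?thesis using True by (simp add: prob_Ws_less f_def)
    next
      case False
      let ?m = "n - i"
      have "?bad i \<subseteq> {\<omega> \<in> space M. Ws i \<omega> < q ^ ?m} \<union>
          {\<omega> \<in> space M. (q ^ 2) ^ ?m \<le> (\<Prod>j\<in>{i..<n}. 1 - Ws j \<omega>)}"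
      proof (rule subsetI, rule ccontr)
        fix \<omega> assume \<omega>: "\<omega> \<in> ?bad i" "\<omega> \<notin> {\<omega> \<in> space M. Ws i \<omega> < q ^ ?m} \<union>
          {\<omega> \<in> space M. (q ^ 2) ^ ?m \<le> (\<Prod>j\<in>{i..<n}. 1 - Ws j \<omega>)}"
        then have "G i \<omega> < (q ^ 2) ^ ?m" "q ^ ?m \<le> Ws i \<omega>" by (auto simp: G_def)
        moreover have "(q ^ 2) ^ ?m = q ^ ?m * q ^ ?m" by (simp add: power2_eq_square power_mult_distrib)
        moreover have "q ^ ?m * q ^ ?m \<le> Ws i \<omega> * q ^ ?m"
          using qm(2)[of ?m] \<open>q ^ ?m \<le> Ws i \<omega>\<close> by (intro mult_right_mono) auto
        ultimately have "G i \<omega> \<le> Ws i \<omega> * q ^ ?m" by linarith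
        then have "b ?m * G i \<omega> \<le> Ws i \<omega>"
          using qm(2)[of ?m] False by (simp add: b_def divide_le_eq)
        with \<omega>(1) show False by simp
      qed
      then have "prob (?bad i) \<le> prob ({\<omega> \<in> space M. Ws i \<omega> < q ^ ?m} \<union>
          {\<omega> \<in> space M. (q ^ 2) ^ ?m \<le> (\<Prod>j\<in>{i..<n}. 1 - Ws j \<omega>)})"
        by (intro finite_measure_mono) measurable
      also have "\<dots> \<le> prob {\<omega> \<in> space M. Ws i \<omega> < q ^ ?m} +
          prob {\<omega> \<in> space M. (q ^ 2) ^ ?m \<le> (\<Prod>j\<in>{i..<n}. 1 - Ws j \<omega>)}"
        by (intro measure_Un_le) measurable
      also have "\<dots> \<le> f ?m + r ^ ?m / (q ^ 2) ^ ?m"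
        using Markov[of "{i..<n}" "(q ^ 2) ^ ?m"] q by (simp add: prob_Ws_less f_def)
      also have "r ^ ?m / (q ^ 2) ^ ?m = (q ^ 2) ^ ?m"
        using q by (simp add: r_eq power_mult_distrib power2_eq_square)
      finally show ?thesis using False by (simp add: g_def)
    qed
    have bads: "prob (\<Union>i<n. ?bad i) \<le> 1 / 2"
    proof -
      have "prob (\<Union>i<n. ?bad i) \<le> (\<Sum>i<n. prob (?bad i))"
        by (intro finite_measure_subadditive_finite) auto
      also have "\<dots> \<le> (\<Sum>i<n. if n - i < m0 then f m1 else g (n - i))"
        by (intro sum_mono bad) simp
      also have "\<dots> = (\<Sum>m\<in>{1..n}. if m < m0 then f m1 else g m)"
        by (rule sum.reindex_bij_witness[of _ "\<lambda>m. n - m" "\<lambda>i. n - i"]) auto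
      also have "\<dots> \<le> (\<Sum>m\<in>{..<m0} \<union> {m0..n}. if m < m0 then f m1 else g m)"
        using g0 by (intro sum_mono2) auto
      also have "\<dots> = (\<Sum>m<m0. f m1) + (\<Sum>m\<in>{m0..n}. g m)"
        by (subst sum.union_disjoint) auto
      also have "(\<Sum>m<m0. f m1) \<le> 1 / 4"
      proof -
        have "(\<Sum>m<m0. f m1) \<le> (real m0 + 1) * f m1" using g0(1)[of m1] by (simp add: algebra_simps)
        also have "\<dots> \<le> 1 / 4" using m1 by (simp add: field_simps)
        finally show ?thesis .
      qed
      finally show ?thesis using tail[of n] by simp
    qed
    have "prob ?S \<le> 1 / 4"
      using Markov[of "{..<n}" "1 / 2"] n0[OF n] by simp
    moreover have "prob ?B \<le> prob (\<Union>i<n. ?bad i) + prob ?S"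
      by (intro measure_Un_le) auto
    ultimately have "prob ?B \<le> 3 / 4" using bads by simp
    moreover have Bm [measurable]: "?B \<in> sets M" by auto
    ultimately have good: "1 / 4 \<le> prob (space M - ?B)" by (simp add: prob_compl)
    have "ennreal (C / 4) \<le> ennreal C * emeasure M (space M - ?B)"
      using good unfolding emeasure_eq_measure C_def by (simp add: ennreal_mult'[symmetric])
    also have "\<dots> = (\<integral>\<^sup>+\<omega>. ennreal C * indicator (space M - ?B) \<omega> \<partial>M)"
      by (subst nn_integral_cmult_indicator) auto
    also have "\<dots> \<le> (\<integral>\<^sup>+\<omega>. ennreal (\<Sum>xs\<in>permutations_of_set {..<n}. succ_prob (stick (\<lambda>i. Ws i \<omega>)) xs) \<partial>M)"
    proof (rule nn_integral_mono)
      fix \<omega> assume \<omega>: "\<omega> \<in> space M"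
      show "ennreal C * indicator (space M - ?B) \<omega> \<le>
        ennreal (\<Sum>xs\<in>permutations_of_set {..<n}. succ_prob (stick (\<lambda>i. Ws i \<omega>)) xs)"
      proof (cases "\<omega> \<in> ?B")
        case False
        have "C \<le> (\<Sum>xs\<in>permutations_of_set {..<n}. succ_prob (stick (\<lambda>i. Ws i \<omega>)) xs)"
          unfolding C_def
        proof (rule sum_succ_prob_stick_ge)
          show "0 \<le> b m" for m using b_ge[of m] qm(2)[of m1] by linarith
          show "b (n - i) * (\<Prod>j=i..<n. 1 - Ws j \<omega>) \<le> Ws i \<omega>" if "i < n" for i
            using False that \<omega> by (auto simp: G_def not_less)
          have "(\<Sum>i<n. exp (- (a * b (n - i)))) = (\<Sum>m\<in>{1..n}. exp (- (a * b m)))"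
            by (rule sum.reindex_bij_witness[of _ "\<lambda>m. n - m" "\<lambda>i. n - i"]) auto
          also have "\<dots> \<le> 1 / 2" by (rule a(2)) simp
          finally show "(\<Sum>i<n. exp (- (a * b (n - i)))) \<le> 1 / 2" .
        qed (use Ws_range[OF \<omega>] False \<omega> a(1) in \<open>auto simp: not_le\<close>)
        then show ?thesis using \<omega> by (simp add: indicator_def ennreal_leI)
      qed simp
    qed
    finally show "ennreal (C / 4) \<le>
      (\<integral>\<^sup>+\<omega>. ennreal (\<Sum>xs\<in>permutations_of_set {..<n}. succ_prob (stick (\<lambda>i. Ws i \<omega>)) xs) \<partial>M)" .
  qed
qed

end

section \<open>Biased permutations of i.i.d. stick-breaking weights\<close>

theorem proposition1p8:
  fixes M :: "'a measure"
    and W :: "'a \<Rightarrow> real" and Ws :: "nat \<Rightarrow> 'a \<Rightarrow> real"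
    and P :: "'a \<Rightarrow> nat \<Rightarrow> real" and \<sigma> :: "'a \<Rightarrow> nat \<Rightarrow> nat"
  assumes "prob_space M"
    and "W \<in> borel_measurable M"
    and "prob_space.indep_vars M (\<lambda>_. borel) Ws UNIV"
    and "\<And>i. distr M borel (Ws i) = distr M borel W"
    and "\<And>\<omega>. \<omega> \<in> space M \<Longrightarrow> 0 < W \<omega> \<and> W \<omega> < 1"
    and "\<And>i \<omega>. \<omega> \<in> space M \<Longrightarrow> 0 < Ws i \<omega> \<and> Ws i \<omega> < 1"
    and "\<And>i \<omega>. \<omega> \<in> space M \<Longrightarrow> P \<omega> i = (\<Prod>j<i. 1 - Ws j \<omega>) * Ws i \<omega>"
    and "biased_permutation M P \<sigma>"
    and nonlattice: "\<And>\<rho>::real. 0 < \<rho> \<Longrightarrow> \<rho> < 1 \<Longrightarrow> \<not> (AE \<omega> in M. \<exists>k::nat. k \<ge> 1 \<and> 1 - W \<omega> = \<rho> ^ k)"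
    and "(\<integral>\<^sup>+ \<omega>. ennreal (- ln (W \<omega>)) \<partial>M) < \<infinity>"
    and "(\<integral>\<^sup>+ \<omega>. ennreal (- ln (1 - W \<omega>)) \<partial>M) < \<infinity>"
  shows "positive_recurrent_regenerative M \<sigma>"
proof -
  interpret iid_factors M W Ws
    using assms by (simp add: iid_factors_def iid_factors_axioms_def)
  have P_eq: "P \<omega> = stick (\<lambda>i. Ws i \<omega>)" if "\<omega> \<in> space M" for \<omega>
    using assms(7)[OF that] by (auto simp: stick_def)
  obtain X where X: "cond_iid_given M P X" and \<sigma>_X: "AE \<omega> in M. \<sigma> \<omega> = distinct_values (X \<omega>)"
    using assms(8) by (auto simp: biased_permutation_def)
  have meas: "\<sigma> \<in> measurable M seq_space" using assms(8) by (simp add: biased_permutation_def)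
  interpret conditionally_iid M P X
  proof unfold_locales
    fix \<omega> assume \<omega>: "\<omega> \<in> space M"
    show "0 < P \<omega> i" for i unfolding P_eq[OF \<omega>] using Ws_range[OF \<omega>] by (rule stick_pos)
    show "sum (P \<omega>) A < 1" if "finite A" for A
      unfolding P_eq[OF \<omega>] using Ws_range[OF \<omega>] that by (rule sum_stick_less_1)
  qed (rule X)
  let ?D = "distr M borel W"
  interpret D: stick_breaking_law ?D
  proof (intro stick_breaking_law.intro stick_breaking_law_axioms.intro)
    show "prob_space ?D" by (rule prob_space_distr) measurable
    show "AE w in ?D. 0 < w \<and> w < 1"
      by (subst AE_distr_iff) (use W_range in auto)
  qed simp
  have Ws_law: "distr M (PiM UNIV (\<lambda>_. borel)) (\<lambda>\<omega> i. Ws i \<omega>) = D.S"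
    using indep distr_Ws by (rule distr_iid_sequence)
  have prefix: "emeasure M {\<omega> \<in> space M. \<sigma> \<omega> \<in> cylinder xs} =
      (\<integral>\<^sup>+\<omega>. ennreal (succ_prob (stick (\<lambda>i. Ws i \<omega>)) xs) \<partial>M)" if "distinct xs" for xs
    using emeasure_distinct_values_prefix[OF meas \<sigma>_X that]
    by (simp add: cylinder_def P_eq cong: nn_integral_cong_simp)
  have prefix_law: "emeasure M {\<omega> \<in> space M. \<sigma> \<omega> \<in> cylinder xs} = D.mean_succ_prob xs" if "distinct xs" for xs
  proof -
    have "(\<lambda>w. succ_prob (stick w) xs) \<in> borel_measurable (PiM UNIV (\<lambda>_. borel))"
      unfolding succ_prob_def stick_def by measurable
    then show ?thesis
      unfolding prefix[OF that] D.mean_succ_prob_def Ws_law[symmetric]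
      by (subst nn_integral_distr) (auto intro!: measurable_PiM_single' simp: space_PiM)
  qed
  interpret factorizing_permutation M \<sigma>
  proof unfold_locales
    show "AE \<omega> in M. bij (\<sigma> \<omega>)"
      using AE_range_sample \<sigma>_X
    proof eventually_elim
      case (elim \<omega>)
      then have inf: "infinite (range (X \<omega>))" by simp
      show ?case
        unfolding elim(2) using inj_distinct_values[OF inf] range_distinct_values[OF inf] elim(1)
        by (simp add: bij_def)
    qed
    fix n and xs ys :: "nat list"
    assume xs: "xs \<in> permutations_of_set {..<n}" and ys: "distinct ys"
    have xs': "set xs = {..<n}" "distinct xs" using xs by (auto simp: permutations_of_set_def)
    have "distinct (xs @ map ((+) n) ys)" using xs' ys by (auto simp: distinct_map)
    then show "emeasure M {\<omega> \<in> space M. \<sigma> \<omega> \<in> cylinder (xs @ map ((+) n) ys)} =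
      emeasure M {\<omega> \<in> space M. \<sigma> \<omega> \<in> cylinder xs} * emeasure M {\<omega> \<in> space M. \<sigma> \<omega> \<in> cylinder ys}"
      using D.mean_succ_prob_append[OF xs ys] xs'(2) ys by (simp add: prefix_law)
  qed (rule meas)
  obtain c n0 where c: "0 < c" "\<And>n. n \<ge> n0 \<Longrightarrow> ennreal c \<le>
      (\<integral>\<^sup>+\<omega>. ennreal (\<Sum>xs\<in>permutations_of_set {..<n}. succ_prob (stick (\<lambda>i. Ws i \<omega>)) xs) \<partial>M)"
    by (rule ex_prob_split_ge) blast
  have split: "emeasure M {\<omega> \<in> space M. splits_at (\<sigma> \<omega>) n} =
      (\<integral>\<^sup>+\<omega>. ennreal (\<Sum>xs\<in>permutations_of_set {..<n}. succ_prob (stick (\<lambda>i. Ws i \<omega>)) xs) \<partial>M)" for n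
  proof -
    have "emeasure M {\<omega> \<in> space M. splits_at (\<sigma> \<omega>) n} =
        (\<Sum>xs\<in>permutations_of_set {..<n}. \<integral>\<^sup>+\<omega>. ennreal (succ_prob (stick (\<lambda>i. Ws i \<omega>)) xs) \<partial>M)"
      unfolding emeasure_splits_at by (intro sum.cong prefix) (auto simp: permutations_of_set_def)
    also have "\<dots> = (\<integral>\<^sup>+\<omega>. (\<Sum>xs\<in>permutations_of_set {..<n}. ennreal (succ_prob (stick (\<lambda>i. Ws i \<omega>)) xs)) \<partial>M)"
      by (subst nn_integral_sum) (auto simp: succ_prob_def stick_def)
    also have "\<dots> = (\<integral>\<^sup>+\<omega>. ennreal (\<Sum>xs\<in>permutations_of_set {..<n}. succ_prob (stick (\<lambda>i. Ws i \<omega>)) xs) \<partial>M)"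
      using Ws_range
      by (intro nn_integral_cong sum_ennreal succ_prob_nonneg stick_pos sum_stick_less_1)
        (auto simp: permutations_of_set_def)
    finally show ?thesis .
  qed
  show ?thesis
    unfolding positive_recurrent_regenerative_def
    using regenerative_splitting_time finite_mean_splitting_time[OF c(1), of n0] c(2) split by simp
qed

end
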